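(* Let $D=(V,A)$ be a digraph such that there exist no two distinct vertices $u,v$ with both $(u,v)\in A$ and $(v,u)\in A$. (a) $U_D$ is $p$-positive: $U_D\in\mathbb{N}[p_1,p_2,p_3,\dots]$. (b) Call a rotation-equivalence class $\gamma$ of nonempty tuples of elements of $V$ risky if its length is even and either $\gamma$ or the reversal of $\gamma$ is a $D$-cycle. Then \[U_D=\sum_{\substack{\sigma\in\mathfrak{S}_V(D,\overline{D});\\ \text{no cycle of }\sigma\text{ is risky}}}p_{\operatorname{type}\sigma}.\]
   Context: A digraph is $D=(V,A)$ with $V$ finite, $A\subseteq V\times V$; $\overline{D}=(V,(V\times V)\setminus A)$; $n=|V|$. A $V$-listing is a tuple $w=(w_1,\dots,w_n)$ containing each element of $V$ exactly once; $\operatorname{Des}(w,D)=\{i\in[n-1]:(w_i,w_{i+1})\in A\}$; $L_{I,n}=\sum x_{i_1}\cdots x_{i_n}$ over positive integers $i_1\le\cdots\le i_n$ with $i_p<i_{p+1}$ for $p\in I$; $U_D=\sum_w L_{\operatorname{Des}(w,D),n}$ over all $V$-listings. Two nonempty tuples are rotation-equivalent if one is a cyclic rotation of the other; the length of a class is that of its tuples; the reversal of the class of $(v_1,\dots,v_k)$ is the class of $(v_k,\dots,v_1)$; $\operatorname{CArcs}$ of that class is $\{(v_1,v_2),\dots,(v_{k-1},v_k),(v_k,v_1)\}$. A $D$-cycle is a rotation-equivalence class $\gamma$ of nonempty tuples of distinct elements of $V$ with $\operatorname{CArcs}\gamma\subseteq A$ (analogously $\overline{D}$-cycle). The cycles of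 $\sigma\in\mathfrak{S}_V$ are the classes of $(i,\sigma(i),\dots,\sigma^{k-1}(i))$ with $k$ minimal such that $\sigma^k(i)=i$. $\mathfrak{S}_V(D,\overline{D})$ is the set of $\sigma\in\mathfrak{S}_V$ all of whose cycles are $D$-cycles or $\overline{D}$-cycles. $\operatorname{type}\sigma$ is the partition of cycle lengths; $p_k=\sum_i x_i^k$, $p_\lambda=\prod_j p_{\lambda_j}$. *)

theory Defs
  imports
    "HOL-Library.Multiset"
    "HOL-Combinatorics.Multiset_Permutations"
    "HOL-Combinatorics.Cycles"
    "Graph_Theory.Pair_Digraph"
begin

section \<open>Formal power series in arbitrarily many commuting variables\<close>

text \<open>
  A monomial in variables indexed by \<^typ>\<open>'v\<close> is the multiset of its variables;
  a formal power series assigns a coefficient to every monomial.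
\<close>

typedef ('v, 'a) mfps = "UNIV :: ('v multiset \<Rightarrow> 'a) set"
  morphisms mcoeff MFPS
  by simp

setup_lifting type_definition_mfps

lemma mfps_eqI: "(\<And>m. mcoeff f m = mcoeff g m) \<Longrightarrow> f = g"
  by (metis ext mcoeff_inject)

lemma finite_mset_splits: "finite {(a, b). a + b = (m :: 'v multiset)}"
proof (induction m)
  case empty
  have "{(a, b). a + b = ({#} :: 'v multiset)} = {({#}, {#})}" by auto
  then show ?case by simp
next
  case (add x m)
  let ?S = "{(a, b). a + b = m}"
  have "{(a, b). a + b = add_mset x m} \<subseteq>
      (\<lambda>(a, b). (add_mset x a, b)) ` ?S \<union> (\<lambda>(a, b). (a, add_mset x b)) ` ?S"
  proof (rule subsetI)
    fix p assume "p \<in> {(a, b). a + b = add_mset x m}"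
    then obtain a b where p: "p = (a, b)" and ab: "a + b = add_mset x m" by auto
    then have "x \<in># a \<or> x \<in># b" by (metis union_iff union_single_eq_member)
    then show "p \<in> (\<lambda>(a, b). (add_mset x a, b)) ` ?S \<union> (\<lambda>(a, b). (a, add_mset x b)) ` ?S"
    proof
      assume "x \<in># a"
      then obtain a' where "a = add_mset x a'" by (metis insert_DiffM)
      with ab p show ?thesis by force
    next
      assume "x \<in># b"
      then obtain b' where "b = add_mset x b'" by (metis insert_DiffM)
      with ab p show ?thesis by force
    qed
  qed
  with add.IH show ?case by (meson finite_UnI finite_imageI finite_subset)
qed

instantiation mfps :: (type, comm_ring_1) comm_ring_1
begin

lift_definition zero_mfps :: "('a, 'b) mfps" is "\<lambda>_. 0" .
lift_definition one_mfps :: "('a, 'b) mfps" is "\<lambda>m. if m = {#} then 1 else 0" .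
lift_definition plus_mfps :: "('a, 'b) mfps \<Rightarrow> ('a, 'b) mfps \<Rightarrow> ('a, 'b) mfps"
  is "\<lambda>f g m. f m + g m" .
lift_definition minus_mfps :: "('a, 'b) mfps \<Rightarrow> ('a, 'b) mfps \<Rightarrow> ('a, 'b) mfps"
  is "\<lambda>f g m. f m - g m" .
lift_definition uminus_mfps :: "('a, 'b) mfps \<Rightarrow> ('a, 'b) mfps"
  is "\<lambda>f m. - f m" .
lift_definition times_mfps :: "('a, 'b) mfps \<Rightarrow> ('a, 'b) mfps \<Rightarrow> ('a, 'b) mfps"
  is "\<lambda>f g m. \<Sum>(a, b)\<in>{(a, b). a + b = m}. f a * g b" .

instance
proof
  fix f g h :: "('a, 'b) mfps"
  show "f * g * h = f * (g * h)"
  proof (rule mfps_eqI)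
    fix m :: "'a multiset"
    let ?S = "\<lambda>m. {(a, b). a + b = (m :: 'a multiset)}"
    let ?T = "{(a, b, c). a + b + c = m}"
    have "mcoeff (f * g * h) m =
        (\<Sum>(d, c)\<in>?S m. \<Sum>(a, b)\<in>?S d. mcoeff f a * mcoeff g b * mcoeff h c)"
      by (simp add: times_mfps.rep_eq sum_distrib_right case_prod_unfold)
    also have "\<dots> = (\<Sum>p\<in>Sigma (?S m) (\<lambda>p. ?S (fst p)).
        mcoeff f (fst (snd p)) * mcoeff g (snd (snd p)) * mcoeff h (snd (fst p)))"
      by (simp add: sum.Sigma case_prod_unfold finite_mset_splits[unfolded case_prod_unfold])
    also have "\<dots> = (\<Sum>(a, b, c)\<in>?T. mcoeff f a * mcoeff g b * mcoeff h c)"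
      by (rule sum.reindex_bij_witness
          [where i = "\<lambda>(a, b, c). ((a + b, c), (a, b))"
            and j = "\<lambda>((d, c), (a, b)). (a, b, c)"]) auto
    also have "\<dots> = (\<Sum>p\<in>Sigma (?S m) (\<lambda>p. ?S (snd p)).
        mcoeff f (fst (fst p)) * (mcoeff g (fst (snd p)) * mcoeff h (snd (snd p))))"
      by (rule sum.reindex_bij_witness
          [where j = "\<lambda>(a, b, c). ((a, b + c), (b, c))"
            and i = "\<lambda>((a, d), (b, c)). (a, b, c)"]) (auto simp: add.assoc mult.assoc)
    also have "\<dots> =
        (\<Sum>(a, d)\<in>?S m. \<Sum>(b, c)\<in>?S d. mcoeff f a * (mcoeff g b * mcoeff h c))"
      by (simp add: sum.Sigma case_prod_unfold finite_mset_splits[unfolded case_prod_unfold])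
    also have "\<dots> = mcoeff (f * (g * h)) m"
      by (simp add: times_mfps.rep_eq sum_distrib_left case_prod_unfold)
    finally show "mcoeff (f * g * h) m = mcoeff (f * (g * h)) m" .
  qed
  show "f * g = g * f"
  proof (rule mfps_eqI)
    fix m
    show "mcoeff (f * g) m = mcoeff (g * f) m"
      unfolding times_mfps.rep_eq
      by (rule sum.reindex_bij_witness[where i = prod.swap and j = prod.swap])
        (auto simp: add.commute mult.commute)
  qed
  show "1 * f = f"
  proof (rule mfps_eqI)
    fix m
    have "mcoeff (1 * f) m = (\<Sum>p\<in>{(a, b). a + b = m}. if p = ({#}, m) then mcoeff f m else 0)"
      unfolding times_mfps.rep_eq one_mfps.rep_eq by (rule sum.cong) (auto split: if_splits)
    also have "\<dots> = mcoeff f m"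
      by (simp add: sum.delta' finite_mset_splits)
    finally show "mcoeff (1 * f) m = mcoeff f m" .
  qed
  show "(f + g) * h = f * h + g * h"
    by (rule mfps_eqI)
      (simp add: times_mfps.rep_eq plus_mfps.rep_eq distrib_right case_prod_unfold sum.distrib)
  show "(0 :: ('a, 'b) mfps) \<noteq> 1"
    by transfer (metis zero_neq_one)
qed (transfer; auto simp: fun_eq_iff algebra_simps)+

end

lift_definition mvar :: "'v \<Rightarrow> ('v, 'a::comm_ring_1) mfps"
  is "\<lambda>i m. if m = {#i#} then 1 else 0" .

text \<open>
  Infinite sums are taken coefficientwise. The sum is meaningful if for every monomial
  only finitely many members of the family have a nonzero coefficient.
\<close>

definition msummable :: "('i \<Rightarrow> ('v, 'a::comm_ring_1) mfps) \<Rightarrow> 'i set \<Rightarrow> bool" where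
  "msummable f S \<longleftrightarrow> (\<forall>m. finite {i \<in> S. mcoeff (f i) m \<noteq> 0})"

lift_definition msum :: "('i \<Rightarrow> ('v, 'a::comm_ring_1) mfps) \<Rightarrow> 'i set \<Rightarrow> ('v, 'a) mfps"
  is "\<lambda>f S m. \<Sum>i\<in>{i \<in> S. f i m \<noteq> 0}. f i m" .

lemma mcoeff_prod_mvar:
  "mcoeff (\<Prod>i\<leftarrow>xs. mvar i :: ('v, 'a::comm_ring_1) mfps) m = (if m = mset xs then 1 else 0)"
proof (induction xs arbitrary: m)
  case Nil
  then show ?case by (simp add: one_mfps.rep_eq)
next
  case (Cons x xs)
  have "mcoeff (\<Prod>i\<leftarrow>x # xs. mvar i :: ('v, 'a) mfps) m =
      (\<Sum>p\<in>{(a, b). a + b = m}. if p = ({#x#}, mset xs) then 1 else 0)"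
    using Cons.IH
    by (auto simp: times_mfps.rep_eq mvar.rep_eq intro!: sum.cong)
  also have "\<dots> = (if m = mset (x # xs) then 1 else 0)"
    by (auto simp: sum.delta' finite_mset_splits)
  finally show ?case .
qed

section \<open>Power sums and fundamental quasisymmetric functions\<close>

text \<open>The variables are those \<^term>\<open>mvar i\<close> with \<^term>\<open>i \<ge> (1::nat)\<close>.\<close>

definition powersum :: "nat \<Rightarrow> (nat, int) mfps" where
  "powersum k = msum (\<lambda>i. mvar i ^ k) {1..}"

text \<open>Partitions are represented by the multisets of their parts.\<close>

definition powersum_partition :: "nat multiset \<Rightarrow> (nat, int) mfps" where
  "powersum_partition la = (\<Prod>k\<in>#la. powersum k)"

text \<open>
  \<open>\<nat>[p\<^sub>1, p\<^sub>2, \<dots>]\<close>, the subsemiring generated by the power sums.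
\<close>

inductive_set powersum_semiring :: "(nat, int) mfps set" where
  zero: "0 \<in> powersum_semiring"
| one: "1 \<in> powersum_semiring"
| gen: "k \<ge> 1 \<Longrightarrow> powersum k \<in> powersum_semiring"
| add: "f \<in> powersum_semiring \<Longrightarrow> g \<in> powersum_semiring \<Longrightarrow> f + g \<in> powersum_semiring"
| mult: "f \<in> powersum_semiring \<Longrightarrow> g \<in> powersum_semiring \<Longrightarrow> f * g \<in> powersum_semiring"

text \<open>
  The entry \<open>i\<^sub>p\<close> of a tuple \<open>(i\<^sub>1, \<dots>, i\<^sub>n)\<close> is \<^term>\<open>is ! (p - 1)\<close>.
\<close>

definition fundamental_indices :: "nat set \<Rightarrow> nat \<Rightarrow> nat list set" where
  "fundamental_indices I n =
    {is. length is = n \<and> (\<forall>i\<in>set is. 1 \<le> i) \<and> sorted is \<and> (\<forall>p\<in>I. is ! (p - 1) < is ! p)}"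

definition fundamental :: "nat set \<Rightarrow> nat \<Rightarrow> (nat, int) mfps" where
  "fundamental I n = msum (\<lambda>is. \<Prod>i\<leftarrow>is. mvar i) (fundamental_indices I n)"

lemma msummable_powersum:
  assumes "k \<ge> 1"
  shows "msummable (\<lambda>i. mvar i ^ k :: (nat, int) mfps) {1..}"
  unfolding msummable_def
proof
  fix m
  have "mcoeff (mvar i ^ k :: (nat, int) mfps) m = (if m = mset (replicate k i) then 1 else 0)" for i
    using mcoeff_prod_mvar[of "replicate k i" m]
    by (simp add: map_replicate prod_list_replicate del: mset_replicate)
  then have "{i \<in> {1..}. mcoeff (mvar i ^ k :: (nat, int) mfps) m \<noteq> 0} \<subseteq> set_mset m"
    using assms by (auto split: if_splits)
  then show "finite {i \<in> {1..}. mcoeff (mvar i ^ k :: (nat, int) mfps) m \<noteq> 0}"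
    by (rule finite_subset) simp
qed

lemma msummable_fundamental:
  "msummable (\<lambda>is. \<Prod>i\<leftarrow>is. mvar i :: (nat, int) mfps) (fundamental_indices I n)"
  unfolding msummable_def
proof
  fix m :: "nat multiset"
  have "{is \<in> fundamental_indices I n. mcoeff (\<Prod>i\<leftarrow>is. mvar i :: (nat, int) mfps) m \<noteq> 0}
      \<subseteq> {is. mset is = m}"
    by (auto simp: mcoeff_prod_mvar split: if_splits)
  moreover have "{is. mset is = m} = permutations_of_multiset m"
    by (simp add: permutations_of_multiset_def)
  ultimately show "finite {is \<in> fundamental_indices I n.
      mcoeff (\<Prod>i\<leftarrow>is. mvar i :: (nat, int) mfps) m \<noteq> 0}"
    by (metis finite_permutations_of_multiset finite_subset)
qed

section \<open>The Redei--Berge symmetric function\<close>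

definition complement_digraph :: "'a pair_pre_digraph \<Rightarrow> 'a pair_pre_digraph" where
  "complement_digraph D =
    \<lparr> pverts = pverts D, parcs = (pverts D \<times> pverts D) - parcs D \<rparr>"

definition Des :: "'a list \<Rightarrow> 'a pair_pre_digraph \<Rightarrow> nat set" where
  "Des w D = {i \<in> {1..length w - 1}. (w ! (i - 1), w ! i) \<in> parcs D}"

text \<open>The \<open>V\<close>-listings are the elements of \<^term>\<open>permutations_of_set V\<close>.\<close>

definition redei_berge :: "'a pair_pre_digraph \<Rightarrow> (nat, int) mfps" where
  "redei_berge D =
    (\<Sum>w\<in>permutations_of_set (pverts D). fundamental (Des w D) (card (pverts D)))"

section \<open>Rotation-equivalence classes\<close>

definition rot_equiv :: "('a list \<times> 'a list) set" where
  "rot_equiv = {(v, w). v \<noteq> [] \<and> w \<noteq> [] \<and> (\<exists>k. w = rotate k v)}"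

lemma equiv_rot_equiv: "equiv {v :: 'a list. v \<noteq> []} rot_equiv"
proof (rule equivI)
  show "rot_equiv \<subseteq> {v :: 'a list. v \<noteq> []} \<times> {v. v \<noteq> []}"
    by (auto simp: rot_equiv_def)
  show "refl_on {v :: 'a list. v \<noteq> []} rot_equiv"
    by (auto simp: rot_equiv_def refl_on_def intro: exI[of _ 0])
  show "sym (rot_equiv :: ('a list \<times> _) set)"
  proof (rule symI)
    fix v w :: "'a list"
    assume "(v, w) \<in> rot_equiv"
    then obtain k where ne: "v \<noteq> []" "w \<noteq> []" and w: "w = rotate k v"
      by (auto simp: rot_equiv_def)
    have "rotate (length v - k mod length v) w =
        rotate (length v - k mod length v) (rotate (k mod length v) v)"
      using w by (metis rotate_conv_mod)
    also have "\<dots> = v"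
      using ne by (simp add: rotate_rotate order_less_imp_le)
    finally show "(w, v) \<in> rot_equiv"
      using ne by (auto simp: rot_equiv_def intro: sym)
  qed
  show "trans (rot_equiv :: ('a list \<times> _) set)"
    by (rule transI) (auto simp: rot_equiv_def rotate_rotate)
qed

definition rot_class :: "'a list \<Rightarrow> 'a list set" where
  "rot_class v = rot_equiv `` {v}"

text \<open>
  The notions for classes are defined through an arbitrary representative;
  the lemmas below show independence of the choice.
\<close>

definition rot_rep :: "'a list set \<Rightarrow> 'a list" where
  "rot_rep \<gamma> = (SOME v. v \<in> \<gamma>)"

definition rot_length :: "'a list set \<Rightarrow> nat" where
  "rot_length \<gamma> = length (rot_rep \<gamma>)"

definition rot_reversal :: "'a list set \<Rightarrow> 'a list set" where
  "rot_reversal \<gamma> = rot_class (rev (rot_rep \<gamma>))"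

definition CArcs :: "'a list set \<Rightarrow> ('a \<times> 'a) set" where
  "CArcs \<gamma> = set (zip (rot_rep \<gamma>) (rotate1 (rot_rep \<gamma>)))"

lemma rot_rep_rot_class:
  assumes "v \<noteq> []"
  shows "(v, rot_rep (rot_class v)) \<in> rot_equiv"
proof -
  have "v \<in> rot_class v"
    using assms by (auto simp: rot_class_def rot_equiv_def intro: exI[of _ 0])
  then have "rot_rep (rot_class v) \<in> rot_class v"
    unfolding rot_rep_def by (rule someI)
  then show ?thesis by (simp add: rot_class_def)
qed

lemma rot_length_rot_class: "v \<noteq> [] \<Longrightarrow> rot_length (rot_class v) = length v"
  using rot_rep_rot_class[of v] by (auto simp: rot_length_def rot_equiv_def)

lemma rot_reversal_rot_class:
  assumes "v \<noteq> []"
  shows "rot_reversal (rot_class v) = rot_class (rev v)"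
proof -
  obtain k where k: "rot_rep (rot_class v) = rotate k v"
    using rot_rep_rot_class[OF assms] by (auto simp: rot_equiv_def)
  have "rev v = rotate k (rev (rotate k v))"
  proof -
    have "rotate k (rev (rotate k v)) = rev v" for v :: "'a list"
    proof (induction k arbitrary: v)
      case (Suc k)
      have "rotate (Suc k) (rev (rotate (Suc k) v)) = rotate1 (rotate k (rev (rotate k (rotate1 v))))"
        by (simp add: rotate1_rotate_swap)
      also have "\<dots> = rotate1 (rev (rotate1 v))" by (simp add: Suc.IH)
      also have "\<dots> = rev v" by (cases v) auto
      finally show ?case .
    qed simp
    then show ?thesis by simp
  qed
  then have "(rev (rotate k v), rev v) \<in> rot_equiv"
    using assms by (auto simp: rot_equiv_def)
  then show ?thesis
    unfolding rot_reversal_def k unfolding rot_class_def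
    by (rule equiv_class_eq[OF equiv_rot_equiv])
qed

lemma CArcs_rot_class:
  assumes "v \<noteq> []"
  shows "CArcs (rot_class v) = set (zip v (rotate1 v))"
proof -
  obtain k where k: "rot_rep (rot_class v) = rotate k v"
    using rot_rep_rot_class[OF assms] by (auto simp: rot_equiv_def)
  have "zip (rotate k v) (rotate1 (rotate k v)) = rotate k (zip v (rotate1 v))"
    by (rule nth_equalityI)
      (use assms in \<open>auto simp: nth_rotate nth_rotate1 mod_simps\<close>)
  then show ?thesis
    by (simp add: CArcs_def k)
qed

section \<open>Cycles of digraphs and permutations\<close>

definition is_digraph_cycle :: "'a pair_pre_digraph \<Rightarrow> 'a list set \<Rightarrow> bool" where
  "is_digraph_cycle D \<gamma> \<longleftrightarrow>
    (\<exists>v. v \<noteq> [] \<and> distinct v \<and> set v \<subseteq> pverts D \<and> \<gamma> = rot_class v) \<and> CArcs \<gamma> \<subseteq> parcs D"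

text \<open>
  A permutation \<open>\<sigma>\<close> of \<open>V\<close> is a function with \<^term>\<open>\<sigma> permutes V\<close>; its cycles are
  those through elements of \<open>V\<close>, with fixed points in \<open>V\<close> giving cycles of length 1.
  \<^term>\<open>support \<sigma> i\<close> is the tuple \<open>(i, \<sigma> i, \<dots>, \<sigma>\<^sup>k\<^sup>-\<^sup>1 i)\<close> with \<open>k\<close> minimal
  such that \<open>\<sigma>\<^sup>k i = i\<close>.
\<close>

definition perm_cycles :: "'a set \<Rightarrow> ('a \<Rightarrow> 'a) \<Rightarrow> 'a list set set" where
  "perm_cycles V \<sigma> = (\<lambda>i. rot_class (support \<sigma> i)) ` V"

definition perm_type :: "'a set \<Rightarrow> ('a \<Rightarrow> 'a) \<Rightarrow> nat multiset" where
  "perm_type V \<sigma> = image_mset rot_length (mset_set (perm_cycles V \<sigma>))"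

definition cycle_perms :: "'a pair_pre_digraph \<Rightarrow> ('a \<Rightarrow> 'a) set" where
  "cycle_perms D = {\<sigma>. \<sigma> permutes pverts D \<and>
    (\<forall>\<gamma>\<in>perm_cycles (pverts D) \<sigma>.
      is_digraph_cycle D \<gamma> \<or> is_digraph_cycle (complement_digraph D) \<gamma>)}"

definition risky :: "'a pair_pre_digraph \<Rightarrow> 'a list set \<Rightarrow> bool" where
  "risky D \<gamma> \<longleftrightarrow> even (rot_length \<gamma>) \<and>
    (is_digraph_cycle D \<gamma> \<or> is_digraph_cycle D (rot_reversal \<gamma>))"

end

theory Submission
  imports Defs "HOL-Combinatorics.Orbits"
begin

text \<open>
  Comparing coefficients, fix a labelling \<open>f\<close> of the vertices by positive integers. The
  corresponding coefficient of \<open>U\<^sub>D\<close> counts the listings along which \<open>f\<close> weakly increases and which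
  use no arc of \<open>D\<close> inside a level of \<open>f\<close>. By inclusion-exclusion this is an alternating sum over
  acyclic arc sets \<open>F\<close> inside the levels, and for such \<open>F\<close> there are as many \<open>f\<close>-sorted listings
  through \<open>F\<close> as permutations \<open>\<sigma>\<close> with \<open>f \<circ> \<sigma> = f\<close> whose graph contains \<open>F\<close>. Exchanging the sums,
  each \<open>\<sigma>\<close> gets the weight \<open>\<Sum> (-1)^card S\<close>, where \<open>S\<close> ranges over the sets of points \<open>x\<close> with
  \<open>(x, \<sigma> x)\<close> an arc that contain no full orbit. It is a product over the cycles of \<open>\<sigma>\<close>, with factor
  \<open>(-1)^(k-1)\<close> for a \<open>D\<close>-cycle of length \<open>k\<close>, factor \<open>1\<close> for a cycle of the complement and factor
  \<open>0\<close> otherwise. Without antiparallel arcs, reversing a risky cycle changes the sign of the weight,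
  so only the permutations without risky cycles survive, with weight \<open>1\<close>. Finally, the number of
  labellings invariant under \<open>\<sigma>\<close> with given content is a coefficient of \<open>p\<^bsub>type \<sigma>\<^esub>\<close>.
\<close>

section \<open>Sorted listings and level-preserving permutations through a set of arcs\<close>

definition list_arcs :: "'a list \<Rightarrow> ('a \<times> 'a) set" where
  "list_arcs w = set (zip w (tl w))"

definition sorted_listings :: "'a set \<Rightarrow> ('a \<Rightarrow> nat) \<Rightarrow> 'a list set" where
  "sorted_listings V f = {w \<in> permutations_of_set V. sorted (map f w)}"

definition level_perms :: "'a set \<Rightarrow> ('a \<Rightarrow> nat) \<Rightarrow> ('a \<Rightarrow> 'a) set" where
  "level_perms V f = {\<sigma>. \<sigma> permutes V \<and> (\<forall>x\<in>V. f (\<sigma> x) = f x)}"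

section \<open>Arcs between consecutive entries of a list\<close>

lemma list_arcs_simps [simp]:
  "list_arcs [] = {}"
  "list_arcs [x] = {}"
  "list_arcs (x # y # ys) = insert (x, y) (list_arcs (y # ys))"
  by (auto simp: list_arcs_def)

text \<open>Keeping \<open>x\<close> on both sides of the cut preserves the arc into
  \<open>x\<close> as well as the arc out of it.\<close>

lemma list_arcs_append_Cons:
  "list_arcs (xs @ x # ys) = list_arcs (xs @ [x]) \<union> list_arcs (x # ys)"
proof (induction xs)
  case (Cons a xs)
  then show ?case by (cases xs) (simp_all add: insert_commute)
qed simp

text \<open>Separates the first pair of a list from the later ones in
  \<open>list_arcs_iff\<close>.\<close>

lemma ex_nat_split: "(\<exists>i. P i) \<longleftrightarrow> P 0 \<or> (\<exists>i. P (Suc i))"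
  by (metis not0_implies_Suc)

lemma list_arcs_iff:
  "(x, y) \<in> list_arcs w \<longleftrightarrow> (\<exists>i. Suc i < length w \<and> x = w ! i \<and> y = w ! Suc i)"
proof (induction w rule: induct_list012)
  case (3 a b ys)
  show ?case
    unfolding list_arcs_simps insert_iff 3
    by (subst (2) ex_nat_split) (auto simp: nth_Cons')
qed auto

lemma list_arcs_subset: "list_arcs w \<subseteq> set w \<times> set w"
  by (auto simp: list_arcs_iff)

lemma list_arcs_split:
  assumes "(u, v) \<in> list_arcs w"
  obtains xs ys where "w = xs @ u # v # ys"
proof -
  obtain i where i: "Suc i < length w" "u = w ! i" "v = w ! Suc i"
    using assms by (auto simp: list_arcs_iff)
  then have "w = take i w @ u # v # drop (Suc (Suc i)) w"
    by (metis Cons_nth_drop_Suc Suc_lessD append_take_drop_id)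
  then show ?thesis using that by blast
qed

lemma finite_list_arcs [simp]: "finite (list_arcs w)"
  by (simp add: list_arcs_def)

lemma list_arcs_functional:
  assumes "distinct w" "(u, v) \<in> list_arcs w" "(u, v') \<in> list_arcs w"
  shows "v = v'"
  using assms by (auto simp: list_arcs_iff nth_eq_iff_index_eq)

lemma list_arcs_injective:
  assumes "distinct w" "(u, v) \<in> list_arcs w" "(u', v) \<in> list_arcs w"
  shows "u = u'"
  using assms by (auto simp: list_arcs_iff nth_eq_iff_index_eq)

text \<open>The arc added in front closes no cycle: \<open>x\<close> does not occur in the rest of
  the list, so no path from \<open>y\<close> returns to it.\<close>

lemma acyclic_list_arcs: "distinct w \<Longrightarrow> acyclic (list_arcs w)"
proof (induction w rule: induct_list012)
  case (3 x y ys)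
  have "(y, x) \<notin> (list_arcs (y # ys))\<^sup>*"
  proof
    assume "(y, x) \<in> (list_arcs (y # ys))\<^sup>*"
    then have "x \<in> set (y # ys)"
      using list_arcs_subset[of "y # ys"] by (cases rule: rtranclE) auto
    with 3 show False by simp
  qed
  with 3 show ?case by (simp add: acyclic_insert)
qed (auto simp: acyclic_def)

lemma finite_sorted_listings [simp]: "finite (sorted_listings V f)"
  by (simp add: sorted_listings_def)

lemma finite_level_perms [simp]: "finite V \<Longrightarrow> finite (level_perms V f)"
  using finite_permutations[of V] by (auto simp: level_perms_def)

text \<open>Fix one sorted listing \<open>w\<close> and send \<sigma> to
  \<open>map \<sigma> w\<close>. Any two sorted listings of \<open>V\<close> have the same sequence
  of labels, so the permutation that matches them position by position preserves \<open>f\<close>.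
  This is the case without prescribed arcs.\<close>

lemma card_sorted_listings:
  assumes "finite V"
  shows "card (sorted_listings V f) = card (level_perms V f)"
proof -
  obtain u where u: "distinct u" "set u = V"
    using finite_distinct_list[OF assms] by blast
  define w where "w = sort_key f u"
  have w: "distinct w" "set w = V" "sorted (map f w)"
    using u by (auto simp: w_def)
  have "bij_betw (\<lambda>\<sigma>. map \<sigma> w) (level_perms V f) (sorted_listings V f)"
    unfolding bij_betw_def
  proof (intro conjI subset_antisym subsetI)
    show "inj_on (\<lambda>\<sigma>. map \<sigma> w) (level_perms V f)"
    proof (rule inj_onI)
      fix \<sigma> \<tau> assume *: "\<sigma> \<in> level_perms V f" "\<tau> \<in> level_perms V f" "map \<sigma> w = map \<tau> w"
      then have "\<sigma> x = \<tau> x" for x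
        using w(2) by (cases "x \<in> V") (auto simp: level_perms_def permutes_def)
      then show "\<sigma> = \<tau>" ..
    qed
  next
    fix v assume "v \<in> (\<lambda>\<sigma>. map \<sigma> w) ` level_perms V f"
    then obtain \<sigma> where s: "\<sigma> permutes V" "\<forall>x\<in>V. f (\<sigma> x) = f x" "v = map \<sigma> w"
      by (auto simp: level_perms_def)
    have "map f v = map f w" using s w by auto
    then have "sorted (map f v)" using w by simp
    moreover have "distinct v" "set v = V"
      using s w by (auto simp: distinct_map permutes_inj_on permutes_image)
    ultimately show "v \<in> sorted_listings V f"
      by (simp add: sorted_listings_def permutations_of_set_def)
  next
    fix v assume v: "v \<in> sorted_listings V f"
    then have v': "distinct v" "set v = V" "sorted (map f v)"
      by (auto simp: sorted_listings_def permutations_of_set_def)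
    have len: "length v = length w"
      using v' w by (metis distinct_card)
    have "mset v = mset w"
      using v' w by (metis set_eq_iff_mset_eq_distinct)
    then have mf: "map f v = map f w"
      using v' w by (metis mset_map properties_for_sort)
    define \<sigma> where "\<sigma> x = (if x \<in> V then the (map_of (zip w v) x) else x)" for x
    have s: "\<sigma> (w ! i) = v ! i" if "i < length w" for i
      using that w len by (auto simp: \<sigma>_def map_of_zip_nth)
    then have mw: "map \<sigma> w = v" using len by (auto intro: nth_equalityI)
    have "\<sigma> permutes V"
    proof (rule bij_imp_permutes)
      have "\<sigma> ` V = V" using mw w v' by (metis set_map)
      then show "bij_betw \<sigma> V V"
        using assms by (simp add: bij_betw_def eq_card_imp_inj_on)
    qed (simp add: \<sigma>_def)
    moreover have "f (\<sigma> x) = f x" if "x \<in> V" for x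
    proof -
      obtain i where "i < length w" "x = w ! i" using \<open>x \<in> V\<close> w by (metis in_set_conv_nth)
      then show ?thesis using s mf len by (metis nth_map)
    qed
    ultimately show "v \<in> (\<lambda>\<sigma>. map \<sigma> w) ` level_perms V f"
      using mw by (auto simp: level_perms_def)
  qed
  then show ?thesis by (simp add: bij_betw_same_card)
qed

section \<open>Deleting a sink from the prescribed arcs\<close>

fun insert_after :: "'a \<Rightarrow> 'a \<Rightarrow> 'a list \<Rightarrow> 'a list" where
  "insert_after u v [] = []"
| "insert_after u v (x # xs) = (if x = u then x # v # xs else x # insert_after u v xs)"

lemma insert_after_append:
  "u \<notin> set xs \<Longrightarrow> insert_after u v (xs @ u # ys) = xs @ u # v # ys"
  by (induction xs) auto

lemma filter_insert_after:
  "v \<notin> set w \<Longrightarrow> filter (\<lambda>x. x \<noteq> v) (insert_after u v w) = w"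
  by (induction w) (auto simp: filter_id_conv)

lemma sorted_map_append_level:
  "f v = f u \<Longrightarrow> sorted (map f (xs @ u # v # ys)) \<longleftrightarrow> sorted (map f (xs @ u # ys))"
  by (auto simp: sorted_append)

text \<open>Deleting \<open>v\<close> undoes inserting it right after \<open>u\<close>, the only
  place that the arc \<open>(u, v)\<close> allows. As \<open>u\<close> and \<open>v\<close> share a
  label, neither operation affects sortedness.\<close>

lemma card_listings_remove_sink:
  assumes uv: "(u, v) \<in> F" and V: "u \<in> V" "v \<in> V" "u \<noteq> v"
    and sink: "v \<notin> Domain F" and out: "\<And>y. (u, y) \<in> F \<Longrightarrow> y = v" and f: "f v = f u"
  shows "card {w \<in> sorted_listings V f. F \<subseteq> list_arcs w} =
    card {w \<in> sorted_listings (V - {v}) f. F - {(u, v)} \<subseteq> list_arcs w}"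
    (is "card ?L = card ?R")
proof -
  have arcs: "F \<subseteq> list_arcs (xs @ u # v # ys) \<longleftrightarrow> F - {(u, v)} \<subseteq> list_arcs (xs @ u # ys)" for xs ys
  proof -
    have 1: "list_arcs (xs @ u # v # ys) = list_arcs (xs @ [u]) \<union> insert (u, v) (list_arcs (v # ys))"
      by (subst list_arcs_append_Cons) simp
    have 2: "list_arcs (xs @ u # ys) = list_arcs (xs @ [u]) \<union> list_arcs (u # ys)"
      by (rule list_arcs_append_Cons)
    show ?thesis
    proof (cases ys)
      case Nil
      then show ?thesis unfolding 1 2 by auto
    next
      case (Cons y zs)
      \<comment> \<open>Inserting \<open>v\<close> trades the arc \<open>(u, y)\<close> for
        \<open>(u, v)\<close> and \<open>(v, y)\<close>; none of these three belongs to
        \<open>F - {(u, v)}\<close>.\<close>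
      have "(v, y) \<notin> F - {(u, v)}" "(u, y) \<notin> F - {(u, v)}" using sink out by auto
      then show ?thesis
        unfolding 1 2 unfolding Cons list_arcs_simps Un_insert_right subset_insert_iff[of F]
        using uv by (simp only: if_True subset_insert not_False_eq_True)
    qed
  qed
  have "bij_betw (insert_after u v) ?R ?L"
    unfolding bij_betw_def
  proof (intro conjI subset_antisym subsetI)
    show "inj_on (insert_after u v) ?R"
      by (rule inj_on_inverseI[where g = "filter (\<lambda>x. x \<noteq> v)"])
        (auto simp: sorted_listings_def permutations_of_set_def filter_insert_after)
  next
    fix w assume "w \<in> insert_after u v ` ?R"
    then obtain w' where w': "w = insert_after u v w'" "distinct w'" "set w' = V - {v}"
      "sorted (map f w')" "F - {(u, v)} \<subseteq> list_arcs w'"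
      by (auto simp: sorted_listings_def permutations_of_set_def)
    then obtain xs ys where xy: "w' = xs @ u # ys" "u \<notin> set xs"
      using V by (metis DiffI singletonD split_list_first)
    have w: "w = xs @ u # v # ys" unfolding w'(1) xy(1) by (rule insert_after_append[OF xy(2)])
    have "distinct (xs @ u # ys)" "v \<notin> set (xs @ u # ys)" "insert v (set (xs @ u # ys)) = V"
      using w'(2,3) V(2) unfolding xy(1) by auto
    then have "distinct w" "set w = V" unfolding w by auto
    moreover have "sorted (map f w)"
      using w'(4) unfolding w xy(1) sorted_map_append_level[of f, OF f] .
    moreover have "F \<subseteq> list_arcs w" using w'(5) unfolding w xy(1) arcs .
    ultimately show "w \<in> ?L"
      by (simp add: sorted_listings_def permutations_of_set_def)
  next
    fix w assume w: "w \<in> ?L"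
    then obtain xs ys where xy: "w = xs @ u # v # ys"
      using list_arcs_split uv by (metis (no_types, lifting) mem_Collect_eq subsetD)
    have d: "distinct w" "set w = V" "sorted (map f w)" "F \<subseteq> list_arcs w"
      using w by (auto simp: sorted_listings_def permutations_of_set_def)
    have "distinct (xs @ u # ys)" "set (xs @ u # ys) = V - {v}" using d xy by auto
    moreover have "sorted (map f (xs @ u # ys))"
      using d(3) unfolding xy sorted_map_append_level[of f, OF f] .
    moreover have "F - {(u, v)} \<subseteq> list_arcs (xs @ u # ys)" using d(4) unfolding xy arcs .
    ultimately have "xs @ u # ys \<in> ?R"
      by (simp add: sorted_listings_def permutations_of_set_def)
    moreover have "w = insert_after u v (xs @ u # ys)"
      using d(1) unfolding xy by (subst insert_after_append) auto
    ultimately show "w \<in> insert_after u v ` ?R" by blast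
  qed
  then show ?thesis by (simp add: bij_betw_same_card)
qed

text \<open>Composition with the transposition is an involution that changes values only at
  \<open>u\<close> and \<open>v\<close>. It turns the condition that \<open>u\<close> maps to
  \<open>v\<close> into the condition that \<open>v\<close> is fixed, and the arcs of
  \<open>F\<close> other than \<open>(u, v)\<close> start at neither point.\<close>

lemma card_perms_remove_sink:
  assumes uv: "(u, v) \<in> F" and V: "u \<in> V" "v \<in> V" "u \<noteq> v"
    and sink: "v \<notin> Domain F" and out: "\<And>y. (u, y) \<in> F \<Longrightarrow> y = v" and f: "f v = f u"
  shows "card {\<sigma> \<in> level_perms V f. \<forall>(x, y)\<in>F. \<sigma> x = y} =
    card {\<sigma> \<in> level_perms (V - {v}) f. \<forall>(x, y)\<in>F - {(u, v)}. \<sigma> x = y}"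
    (is "card ?L = card ?R")
proof -
  let ?t = "transpose u v"
  have "bij_betw (\<lambda>\<sigma>. \<sigma> \<circ> ?t) ?R ?L" \<comment> \<open>splices \<open>v\<close> into the cycle of \<open>u\<close>, right after \<open>u\<close>\<close>
  proof (rule bij_betw_byWitness[where f' = "\<lambda>\<sigma>. \<sigma> \<circ> ?t"])
    show "(\<lambda>\<sigma>. \<sigma> \<circ> ?t) ` ?R \<subseteq> ?L"
    proof clarify
      fix \<sigma> assume s: "\<sigma> \<in> level_perms (V - {v}) f" "\<forall>(x, y)\<in>F - {(u, v)}. \<sigma> x = y"
      have p: "\<sigma> permutes V - {v}" and fs: "\<forall>x\<in>V - {v}. f (\<sigma> x) = f x"
        using s by (auto simp: level_perms_def)
      have "\<sigma> permutes V" using p by (rule permutes_subset) auto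
      then have "\<sigma> \<circ> ?t permutes V"
        using V by (simp add: permutes_compose permutes_swap_id)
      moreover have "f ((\<sigma> \<circ> ?t) x) = f x" if "x \<in> V" for x
        using that fs V f permutes_not_in[OF p, of v] by (auto simp: transpose_def)
      moreover have "(\<sigma> \<circ> ?t) x = y" if "(x, y) \<in> F" for x y
        using that s(2) out[of y] sink permutes_not_in[OF p, of v] by (force simp: transpose_def)
      ultimately show "\<sigma> \<circ> ?t \<in> level_perms V f \<and> (\<forall>(x, y)\<in>F. (\<sigma> \<circ> ?t) x = y)"
        by (auto simp: level_perms_def)
    qed
    show "(\<lambda>\<sigma>. \<sigma> \<circ> ?t) ` ?L \<subseteq> ?R"
    proof clarify
      fix \<sigma> assume s: "\<sigma> \<in> level_perms V f" "\<forall>(x, y)\<in>F. \<sigma> x = y"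
      have p: "\<sigma> permutes V" and fs: "\<forall>x\<in>V. f (\<sigma> x) = f x"
        using s by (auto simp: level_perms_def)
      have su: "\<sigma> u = v" using s(2) uv by auto
      have pt: "\<sigma> \<circ> ?t permutes V"
        using V p by (simp add: permutes_compose permutes_swap_id)
      have "\<sigma> \<circ> ?t permutes V - {v}"
        by (rule permutes_superset[OF pt]) (use su in auto)
      moreover have "f ((\<sigma> \<circ> ?t) x) = f x" if "x \<in> V - {v}" for x
        using that fs V f by (auto simp: transpose_def)
      moreover have "(\<sigma> \<circ> ?t) x = y" if xy: "(x, y) \<in> F - {(u, v)}" for x y
      proof -
        have "x \<noteq> v" "x \<noteq> u" using xy sink out by auto
        then show ?thesis using xy s(2) by auto
      qed
      ultimately show "\<sigma> \<circ> ?t \<in> level_perms (V - {v}) f \<and> (\<forall>(x, y)\<in>F - {(u, v)}. (\<sigma> \<circ> ?t) x = y)"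
        by (auto simp: level_perms_def)
    qed
  qed (auto simp: comp_assoc)
  then show ?thesis by (simp add: bij_betw_same_card)
qed

text \<open>Deleting a sink together with its only incoming arc affects neither count, as long as
  \<open>F\<close> does not branch there; where it branches, both counts vanish. Once no arcs are
  left, \<open>card_sorted_listings\<close> applies.\<close>

lemma card_listings_eq_card_perms:
  assumes "finite V" "F \<subseteq> V \<times> V" "acyclic F" "\<And>u v. (u, v) \<in> F \<Longrightarrow> f v = f u"
  shows "card {w \<in> sorted_listings V f. F \<subseteq> list_arcs w} =
    card {\<sigma> \<in> level_perms V f. \<forall>(x, y)\<in>F. \<sigma> x = y}"
  using assms
proof (induction "card V" arbitrary: V F)
  case 0
  then show ?case by (simp add: card_sorted_listings)
next
  case (Suc n)
  have fin: "finite F" using Suc.prems by (meson finite_SigmaI finite_subset)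
  show ?case
  proof (cases "F = {}")
    case True
    then show ?thesis using Suc.prems by (simp add: card_sorted_listings)
  next
    case False
    \<comment> \<open>Induct by deleting a sink \<open>v\<close> of \<open>F\<close>.\<close>
    have "wf (F\<inverse>)" using fin Suc.prems by (simp add: finite_acyclic_wf_converse)
    moreover have "Range F \<noteq> {}" using False by auto
    then obtain z where "z \<in> Range F" by blast
    \<comment> \<open>Minimality is taken inside \<open>Range F\<close>: this gives \<open>v\<close>
      an incoming arc, and an out-neighbour of \<open>v\<close> would again lie in
      \<open>Range F\<close>, so \<open>v\<close> is a sink.\<close>
    ultimately obtain v where v: "v \<in> Range F" "\<And>y. (y, v) \<in> F\<inverse> \<Longrightarrow> y \<notin> Range F"
      by (rule wfE_min) blast
    then obtain u where uv: "(u, v) \<in> F" by auto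
    have sink: "v \<notin> Domain F" using v by auto
    have ne: "u \<noteq> v" using sink uv by auto
    have V: "u \<in> V" "v \<in> V" using uv Suc.prems by auto
    show ?thesis
    \<comment> \<open>If \<open>u\<close> has a second out-neighbour or \<open>v\<close> a second
      in-neighbour, both sets are empty: the arcs of a listing, like the graph of a permutation,
      form a partial injection.\<close>
    proof (cases "(\<forall>y. (u, y) \<in> F \<longrightarrow> y = v) \<and> (\<forall>x. (x, v) \<in> F \<longrightarrow> x = u)")
      case True
      have "card {w \<in> sorted_listings (V - {v}) f. F - {(u, v)} \<subseteq> list_arcs w} =
          card {\<sigma> \<in> level_perms (V - {v}) f. \<forall>(x, y)\<in>F - {(u, v)}. \<sigma> x = y}"
      proof (rule Suc.hyps(1))
        show "n = card (V - {v})" using Suc.hyps(2) V by simp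
        show "F - {(u, v)} \<subseteq> (V - {v}) \<times> (V - {v})"
        proof (rule subrelI)
          fix x y assume xy: "(x, y) \<in> F - {(u, v)}"
          then have "x \<in> V" "y \<in> V" using Suc.prems(2) by auto
          moreover have "x \<noteq> v" "y \<noteq> v" using xy sink True by auto
          ultimately show "(x, y) \<in> (V - {v}) \<times> (V - {v})" by simp
        qed
        show "acyclic (F - {(u, v)})" using Suc.prems by (meson Diff_subset acyclic_subset)
        show "finite (V - {v})" using Suc.prems(1) by simp
        show "f y = f x" if "(x, y) \<in> F - {(u, v)}" for x y using that Suc.prems(4) by blast
      qed
      moreover have out: "y = v" if "(u, y) \<in> F" for y using True that by blast
      ultimately show ?thesis
        using card_listings_remove_sink[of u v F V f, OF uv V ne sink out Suc.prems(4)[OF uv]]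
          card_perms_remove_sink[of u v F V f, OF uv V ne sink out Suc.prems(4)[OF uv]] by presburger
    next
      case False
      have "{w \<in> sorted_listings V f. F \<subseteq> list_arcs w} = {}"
      proof -
        have "\<not> F \<subseteq> list_arcs w" if "w \<in> sorted_listings V f" for w
        proof
          assume "F \<subseteq> list_arcs w"
          moreover have "distinct w"
            using that by (auto simp: sorted_listings_def permutations_of_set_def)
          ultimately show False
            using False uv list_arcs_functional list_arcs_injective by (metis subsetD)
        qed
        then show ?thesis by auto
      qed
      moreover have "{\<sigma> \<in> level_perms V f. \<forall>(x, y)\<in>F. \<sigma> x = y} = {}"
      proof -
        have "\<not> (\<forall>(x, y)\<in>F. \<sigma> x = y)" if "\<sigma> \<in> level_perms V f" for \<sigma>
        proof
          assume *: "\<forall>(x, y)\<in>F. \<sigma> x = y"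
          have "inj \<sigma>" using that by (auto simp: level_perms_def permutes_inj)
          have "y = v" if "(u, y) \<in> F" for y using bspec[OF * uv] bspec[OF * that] by simp
          moreover have "x = u" if "(x, v) \<in> F" for x
            using bspec[OF * uv] bspec[OF * that] \<open>inj \<sigma>\<close> by (simp add: inj_def)
          ultimately show False using False by blast
        qed
        then show ?thesis by auto
      qed
      ultimately show ?thesis by (simp only: card.empty)
    qed
  qed
qed

section \<open>Inclusion-exclusion\<close>

lemma alternating_sum_Pow:
  "finite X \<Longrightarrow> (\<Sum>S\<in>Pow X. (-1) ^ card S :: int) = (if X = {} then 1 else 0)"
proof (induction X rule: finite_induct)
  case (insert x X)
  have "(\<Sum>S\<in>Pow (insert x X). (-1) ^ card S :: int) =
      (\<Sum>S\<in>Pow X. (-1) ^ card S) + (\<Sum>S\<in>insert x ` Pow X. (-1) ^ card S)"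
    unfolding Pow_insert using insert.hyps by (intro sum.union_disjoint) auto
  also have "(\<Sum>S\<in>insert x ` Pow X. (-1) ^ card S :: int) = (\<Sum>S\<in>Pow X. (-1) ^ card (insert x S))"
  proof (subst sum.reindex)
    show "inj_on (insert x) (Pow X)"
      using insert.hyps by (auto simp: inj_on_def)
  qed simp
  also have "\<dots> = (\<Sum>S\<in>Pow X. - ((-1) ^ card S))"
  proof (rule sum.cong)
    fix S assume "S \<in> Pow X"
    then have "finite S" "x \<notin> S" using insert.hyps by (auto intro: finite_subset)
    then show "(-1) ^ card (insert x S) = (- ((-1) ^ card S) :: int)" by simp
  qed simp
  finally show ?case by (simp add: sum_negf)
qed simp

text \<open>A set \<open>S\<close> splits uniquely into its traces on the disjoint blocks. The sign
  is multiplicative over the traces, and whether \<open>S\<close> contains a block depends on the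
  trace on that block alone.\<close>

lemma alternating_sum_partition:
  fixes T :: "'a set"
  assumes "finite \<Q>" "\<And>Q. Q \<in> \<Q> \<Longrightarrow> finite Q" "disjoint \<Q>"
  shows "(\<Sum>S | S \<subseteq> \<Union>\<Q> \<inter> T \<and> (\<forall>Q\<in>\<Q>. \<not> Q \<subseteq> S). (-1) ^ card S :: int) =
    (\<Prod>Q\<in>\<Q>. \<Sum>S | S \<subseteq> Q \<inter> T \<and> \<not> Q \<subseteq> S. (-1) ^ card S)"
  using assms
proof (induction \<Q> rule: finite_induct)
  case (insert Q \<Q>)
  define X where "X = {S. S \<subseteq> Q \<inter> T \<and> \<not> Q \<subseteq> S}"
  define Y where "Y = {S. S \<subseteq> \<Union>\<Q> \<inter> T \<and> (\<forall>Q\<in>\<Q>. \<not> Q \<subseteq> S)}"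
  have disj: "Q \<inter> R = {}" if "R \<in> \<Q>" for R
    using insert.prems(2) insert.hyps(2) that by (auto simp: pairwise_insert disjnt_def)
  have fin: "finite Q" "finite (\<Union>\<Q>)" using insert by auto
  have "(\<Sum>S | S \<subseteq> \<Union>(insert Q \<Q>) \<inter> T \<and> (\<forall>R\<in>insert Q \<Q>. \<not> R \<subseteq> S). (-1) ^ card S :: int) =
      (\<Sum>(S, S')\<in>X \<times> Y. (-1) ^ card S * (-1) ^ card S')"
  proof (rule sum.reindex_bij_witness
      [where i = "\<lambda>(S, S'). S \<union> S'" and j = "\<lambda>S. (S \<inter> Q, S \<inter> \<Union>\<Q>)"], goal_cases)
    case (1 S)
    then show ?case by auto
  next
    case (2 S)
    then have S: "S \<subseteq> (Q \<union> \<Union>\<Q>) \<inter> T" "\<not> Q \<subseteq> S" "\<forall>R\<in>\<Q>. \<not> R \<subseteq> S" by auto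
    then show ?case by (auto simp: X_def Y_def)
  next
    case (3 p)
    obtain S S' where p: "p = (S, S')" by (cases p)
    with 3 have "S \<subseteq> Q" "S' \<subseteq> \<Union>\<Q>" by (auto simp: X_def Y_def)
    then show ?case using disj p by auto
  next
    case (4 p)
    obtain S S' where p: "p = (S, S')" by (cases p)
    with 4 have S: "S \<subseteq> Q \<inter> T" "S' \<subseteq> \<Union>\<Q> \<inter> T" "\<not> Q \<subseteq> S" "\<forall>R\<in>\<Q>. \<not> R \<subseteq> S'"
      by (auto simp: X_def Y_def)
    have "Q \<inter> S' = {}" using disj S(2) by fast
    then have "\<not> Q \<subseteq> S \<union> S'" using S(3) by auto
    moreover have "\<not> R \<subseteq> S \<union> S'" if "R \<in> \<Q>" for R
    proof -
      have "R \<inter> S = {}" using disj[OF that] S(1) by auto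
      then show ?thesis using S(4) that by auto
    qed
    ultimately show ?case using S(1,2) p by auto
  next
    case (5 S)
    then have "S = (S \<inter> Q) \<union> (S \<inter> \<Union>\<Q>)" by auto
    moreover have "(S \<inter> Q) \<inter> (S \<inter> \<Union>\<Q>) = {}" using disj by auto
    ultimately have "card S = card (S \<inter> Q) + card (S \<inter> \<Union>\<Q>)"
      using fin by (metis card_Un_disjoint finite_Int)
    then show ?case by (simp add: power_add)
  qed
  also have "\<dots> = (\<Sum>S\<in>X. (-1) ^ card S) * (\<Sum>S\<in>Y. (-1) ^ card S)"
    by (simp add: sum_product sum.cartesian_product)
  also have "(\<Sum>S\<in>Y. (-1) ^ card S :: int) =
      (\<Prod>Q\<in>\<Q>. \<Sum>S | S \<subseteq> Q \<inter> T \<and> \<not> Q \<subseteq> S. (-1) ^ card S)"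
    unfolding Y_def using insert.prems by (intro insert.IH) (auto simp: pairwise_insert)
  finally show ?case using insert.hyps by (simp add: X_def)
qed simp

section \<open>The weight of a single orbit\<close>

definition orbit_sign :: "('a \<times> 'a) set \<Rightarrow> ('a \<Rightarrow> 'a) \<Rightarrow> 'a set \<Rightarrow> int" where
  "orbit_sign A \<sigma> Q =
    (if \<forall>x\<in>Q. (x, \<sigma> x) \<in> A then - ((-1) ^ card Q)
     else if \<forall>x\<in>Q. (x, \<sigma> x) \<notin> A then 1 else 0)"

lemma orbit_sign_cong:
  "(\<And>x. x \<in> Q \<Longrightarrow> \<sigma> x = \<tau> x) \<Longrightarrow> orbit_sign A \<sigma> Q = orbit_sign A \<tau> Q"
  by (simp add: orbit_sign_def)

text \<open>If all arcs of the orbit lie in \<open>A\<close>, the vanishing sum over all subsets of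
  \<open>Q\<close> lacks only the term of \<open>Q\<close> itself. Otherwise no admissible
  \<open>S\<close> can contain \<open>Q\<close>, and the full alternating sum is 0 unless there is
  no arc to choose from.\<close>

lemma alternating_sum_proper_subsets:
  assumes "finite Q" "Q \<noteq> {}"
  shows "(\<Sum>S | S \<subseteq> Q \<inter> {x. (x, \<sigma> x) \<in> A} \<and> \<not> Q \<subseteq> S. (-1) ^ card S) = orbit_sign A \<sigma> Q"
proof (cases "\<forall>x\<in>Q. (x, \<sigma> x) \<in> A")
  case True
  then have "{S. S \<subseteq> Q \<inter> {x. (x, \<sigma> x) \<in> A} \<and> \<not> Q \<subseteq> S} = Pow Q - {Q}" by auto
  then show ?thesis
    using True assms by (simp add: orbit_sign_def sum_diff1 alternating_sum_Pow)
next
  case False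
  then have "{S. S \<subseteq> Q \<inter> {x. (x, \<sigma> x) \<in> A} \<and> \<not> Q \<subseteq> S} = Pow (Q \<inter> {x. (x, \<sigma> x) \<in> A})" by auto
  moreover have "Q \<inter> {x. (x, \<sigma> x) \<in> A} = {} \<longleftrightarrow> (\<forall>x\<in>Q. (x, \<sigma> x) \<notin> A)" by auto
  moreover have "finite (Q \<inter> {x. (x, \<sigma> x) \<in> A})" using assms(1) by simp
  ultimately show ?thesis
    unfolding orbit_sign_def if_not_P[OF False] by (simp only: alternating_sum_Pow)
qed

section \<open>Orbits and acyclic parts of the graph of a permutation\<close>

lemma orbit_eq_if_mem:
  assumes "permutation \<sigma>" "y \<in> orbit \<sigma> x"
  shows "orbit \<sigma> y = orbit \<sigma> x"
  using orbit_cyclic_eq3[OF cyclic_on_orbit'[OF assms(1)] assms(2)] .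

lemma disjoint_orbits:
  assumes "permutation \<sigma>"
  shows "disjoint (orbit \<sigma> ` V)"
proof (rule disjointI)
  fix Q R assume "Q \<in> orbit \<sigma> ` V" "R \<in> orbit \<sigma> ` V" "Q \<noteq> R"
  then show "Q \<inter> R = {}" using orbit_eq_if_mem[OF assms] by blast
qed

lemma finite_orbit_permutation: "permutation \<sigma> \<Longrightarrow> finite (orbit \<sigma> x)"
  by (simp add: finite_orbit permutation_self_in_orbit)

lemma Union_orbits:
  assumes "finite V" "\<sigma> permutes V"
  shows "\<Union>(orbit \<sigma> ` V) = V"
  proof -
  have "permutation \<sigma>" using assms permutation_permutes by blast
  then show ?thesis
    using permutes_orbit_subset[OF assms(2)] permutation_self_in_orbit by fast
qed

text \<open>A path in the graph of \<sigma> follows the iterates of \<sigma>. Hence a closed path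
  through \<open>x\<close> visits the whole orbit of \<open>x\<close>, and conversely an orbit
  inside \<open>S\<close> forms a cycle.\<close>

lemma acyclic_graph_on_iff:
  assumes "finite V" "\<sigma> permutes V" "S \<subseteq> V"
  shows "acyclic ((\<lambda>x. (x, \<sigma> x)) ` S) \<longleftrightarrow> (\<forall>Q\<in>orbit \<sigma> ` V. \<not> Q \<subseteq> S)"
proof -
  let ?F = "(\<lambda>x. (x, \<sigma> x)) ` S"
  have perm: "permutation \<sigma>" using assms permutation_permutes by blast
  have "\<not> acyclic ?F" if "orbit \<sigma> x \<subseteq> S" for x
  proof -
    have "(x, y) \<in> ?F\<^sup>+" if "y \<in> orbit \<sigma> x" for y
      using that
    proof induction
      case base
      have "x \<in> S" using \<open>orbit \<sigma> x \<subseteq> S\<close> permutation_self_in_orbit[OF perm] by blast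
      then show ?case by blast
    next
      case (step y)
      then have "(y, \<sigma> y) \<in> ?F" using \<open>orbit \<sigma> x \<subseteq> S\<close> by blast
      with step show ?case by (meson trancl.trancl_into_trancl)
    qed
    then show ?thesis using permutation_self_in_orbit[OF perm] by (auto simp: acyclic_def)
  qed
  moreover have "\<exists>x\<in>V. orbit \<sigma> x \<subseteq> S" if cyc: "(x, x) \<in> ?F\<^sup>+" for x
  proof -
    \<comment> \<open>The induction also records that every iterate before the endpoint lies in
      \<open>S\<close>; for a closed path these iterates exhaust the orbit.\<close>
    have "\<exists>k>0. (\<sigma> ^^ k) x = y \<and> (\<forall>j<k. (\<sigma> ^^ j) x \<in> S)" if "(x, y) \<in> ?F\<^sup>+" for y
      using that
    proof induction
      case (base y)
      then show ?case by (intro exI[of _ 1]) auto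
    next
      case (step y z)
      then obtain k where "k > 0" "(\<sigma> ^^ k) x = y" "\<forall>j<k. (\<sigma> ^^ j) x \<in> S" by blast
      moreover have "y \<in> S" "z = \<sigma> y" using step by auto
      ultimately show ?case by (intro exI[of _ "Suc k"]) (auto simp: less_Suc_eq)
    qed
    from this[OF cyc] obtain k where k: "k > 0" "(\<sigma> ^^ k) x = x" "\<forall>j<k. (\<sigma> ^^ j) x \<in> S"
      by blast
    then have "orbit \<sigma> x \<subseteq> S"
      using orbit_altdef_bounded[of k \<sigma> x] by auto
    moreover have "x \<in> V" using k assms by (metis funpow_0 subsetD)
    ultimately show ?thesis by blast
  qed
  ultimately show ?thesis by (auto simp: acyclic_def)
qed

text \<open>An arc set inside the graph of \<sigma> is determined by its set of tails. The two ends
  of such an arc automatically have the same label, and acyclicity says that the tails contain no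
  full orbit, so the sum factors over the orbits.\<close>

lemma alternating_sum_acyclic_subgraphs:
  assumes "finite V" "\<sigma> \<in> level_perms V f"
  shows "(\<Sum>F | F \<subseteq> {(u, v) \<in> A. u \<in> V \<and> v \<in> V \<and> f u = f v} \<and> acyclic F \<and> (\<forall>(x, y)\<in>F. \<sigma> x = y).
      (-1) ^ card F) = (\<Prod>Q\<in>orbit \<sigma> ` V. orbit_sign A \<sigma> Q)"
proof -
  have p: "\<sigma> permutes V" and f: "\<And>x. x \<in> V \<Longrightarrow> f (\<sigma> x) = f x"
    using assms by (auto simp: level_perms_def)
  have perm: "permutation \<sigma>" using assms p permutation_permutes by blast
  have inj: "inj_on (\<lambda>x. (x, \<sigma> x)) S" for S by (auto simp: inj_on_def)
  have "(\<Sum>F | F \<subseteq> {(u, v) \<in> A. u \<in> V \<and> v \<in> V \<and> f u = f v} \<and> acyclic F \<and> (\<forall>(x, y)\<in>F. \<sigma> x = y).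
      (-1) ^ card F :: int) =
    (\<Sum>S | S \<subseteq> V \<inter> {x. (x, \<sigma> x) \<in> A} \<and> (\<forall>Q\<in>orbit \<sigma> ` V. \<not> Q \<subseteq> S). (-1) ^ card S)"
  proof (rule sum.reindex_bij_witness
      [where i = "\<lambda>S. (\<lambda>x. (x, \<sigma> x)) ` S" and j = "\<lambda>F. fst ` F"], goal_cases)
    case (1 F)
    then have "(x, y) \<in> F \<Longrightarrow> \<sigma> x = y" for x y by auto
    then show ?case by (auto simp: image_image intro: rev_image_eqI)
  next
    case (2 F)
    then have s: "\<And>x y. (x, y) \<in> F \<Longrightarrow> \<sigma> x = y" by auto
    then have F: "F = (\<lambda>x. (x, \<sigma> x)) ` fst ` F" by (auto simp: image_image intro: rev_image_eqI)
    have sub: "fst ` F \<subseteq> V \<inter> {x. (x, \<sigma> x) \<in> A}"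
    proof
      fix x assume "x \<in> fst ` F"
      then obtain y where "(x, y) \<in> F" by auto
      with s[OF this] 2 show "x \<in> V \<inter> {x. (x, \<sigma> x) \<in> A}" by blast
    qed
    then have "\<forall>Q\<in>orbit \<sigma> ` V. \<not> Q \<subseteq> fst ` F"
      using 2 acyclic_graph_on_iff[OF assms(1) p, of "fst ` F", folded F] by blast
    with sub show ?case by blast
  next
    case (3 S)
    then show ?case by force
  next
    case (4 S)
    then have "acyclic ((\<lambda>x. (x, \<sigma> x)) ` S)"
      using acyclic_graph_on_iff[OF assms(1) p, of S] by auto
    moreover have "(\<lambda>x. (x, \<sigma> x)) ` S \<subseteq> {(u, v) \<in> A. u \<in> V \<and> v \<in> V \<and> f u = f v}"
      using 4 f permutes_in_image[OF p] by auto
    ultimately show ?case by auto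
  next
    case (5 F)
    then have "\<And>x y. (x, y) \<in> F \<Longrightarrow> \<sigma> x = y" by auto
    then have "inj_on fst F" by (metis inj_onI prod.collapse)
    then show ?case by (simp add: card_image)
  qed
  also have "\<dots> = (\<Prod>Q\<in>orbit \<sigma> ` V. \<Sum>S | S \<subseteq> Q \<inter> {x. (x, \<sigma> x) \<in> A} \<and> \<not> Q \<subseteq> S. (-1) ^ card S)"
    using alternating_sum_partition[of "orbit \<sigma> ` V" "{x. (x, \<sigma> x) \<in> A}"]
      Union_orbits[OF assms(1) p] assms(1) finite_orbit_permutation[OF perm] disjoint_orbits[OF perm]
    by auto
  also have "\<dots> = (\<Prod>Q\<in>orbit \<sigma> ` V. orbit_sign A \<sigma> Q)"
  proof (rule prod.cong)
    fix Q assume "Q \<in> orbit \<sigma> ` V"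
    then have "finite Q" "Q \<noteq> {}" using finite_orbit_permutation[OF perm] by (auto simp: orbit_nonempty)
    then show "(\<Sum>S | S \<subseteq> Q \<inter> {x. (x, \<sigma> x) \<in> A} \<and> \<not> Q \<subseteq> S. (-1) ^ card S) = orbit_sign A \<sigma> Q"
      by (rule alternating_sum_proper_subsets)
  qed simp
  finally show ?thesis .
qed

text \<open>The absence of forbidden arcs is expanded as an alternating sum over sets
  \<open>F\<close> of forbidden arcs. After exchanging the sums, listings through \<open>F\<close>
  are replaced by permutations through \<open>F\<close>, and a second exchange collects the weight
  of each permutation.\<close>

lemma card_compatible_listings:
  assumes "finite V"
  shows "int (card {w \<in> sorted_listings V f. \<forall>(u, v)\<in>list_arcs w. (u, v) \<in> A \<longrightarrow> f u \<noteq> f v}) =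
    (\<Sum>\<sigma>\<in>level_perms V f. \<Prod>Q\<in>orbit \<sigma> ` V. orbit_sign A \<sigma> Q)"
proof -
  define B where "B = {(u, v) \<in> A. u \<in> V \<and> v \<in> V \<and> f u = f v}"
  define \<F> where "\<F> = {F. F \<subseteq> B \<and> acyclic F}"
  have B: "B \<subseteq> V \<times> V" by (auto simp: B_def)
  have "finite B" using finite_subset[OF B] assms by simp
  then have fin: "finite \<F>" by (auto simp: \<F>_def intro: finite_subset[of _ "Pow B"])
  have indicator: "(if \<forall>(u, v)\<in>list_arcs w. (u, v) \<in> A \<longrightarrow> f u \<noteq> f v then 1 else 0 :: int) =
      (\<Sum>F\<in>\<F>. if F \<subseteq> list_arcs w then (-1) ^ card F else 0)"
    if "w \<in> sorted_listings V f" for w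
  proof -
    have w: "distinct w" "set w = V"
      using that by (auto simp: sorted_listings_def permutations_of_set_def)
    have "(\<Sum>F\<in>\<F>. if F \<subseteq> list_arcs w then (-1) ^ card F else 0 :: int) =
        (\<Sum>F | F \<in> \<F> \<and> F \<subseteq> list_arcs w. (-1) ^ card F)"
      using fin by (simp add: sum.inter_filter)
    \<comment> \<open>Arc sets contained in a listing are acyclic anyway, so restricting the family
      to acyclic sets loses no term.\<close>
    also have "{F. F \<in> \<F> \<and> F \<subseteq> list_arcs w} = Pow (list_arcs w \<inter> B)"
      using acyclic_list_arcs[OF w(1)] by (auto simp: \<F>_def intro: acyclic_subset)
    also have "(\<Sum>F\<in>Pow (list_arcs w \<inter> B). (-1) ^ card F :: int) =
        (if list_arcs w \<inter> B = {} then 1 else 0)"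
      by (rule alternating_sum_Pow) simp
    also have "list_arcs w \<inter> B = {} \<longleftrightarrow> (\<forall>(u, v)\<in>list_arcs w. (u, v) \<in> A \<longrightarrow> f u \<noteq> f v)"
      using list_arcs_subset[of w] w by (auto simp: B_def)
    finally show ?thesis by simp
  qed
  have "int (card {w \<in> sorted_listings V f. \<forall>(u, v)\<in>list_arcs w. (u, v) \<in> A \<longrightarrow> f u \<noteq> f v}) =
      (\<Sum>w\<in>sorted_listings V f. if \<forall>(u, v)\<in>list_arcs w. (u, v) \<in> A \<longrightarrow> f u \<noteq> f v then 1 else 0)"
    by (simp flip: sum.inter_filter)
  also have "\<dots> = (\<Sum>w\<in>sorted_listings V f. \<Sum>F\<in>\<F>. if F \<subseteq> list_arcs w then (-1) ^ card F else 0)"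
    by (intro sum.cong refl indicator)
  also have "\<dots> = (\<Sum>F\<in>\<F>. \<Sum>w\<in>sorted_listings V f. if F \<subseteq> list_arcs w then (-1) ^ card F else 0)"
    by (rule sum.swap)
  also have "\<dots> = (\<Sum>F\<in>\<F>. (-1) ^ card F * int (card {w \<in> sorted_listings V f. F \<subseteq> list_arcs w}))"
    by (simp add: mult.commute flip: sum.inter_filter)
  \<comment> \<open>Here listings turn into permutations; acyclicity of \<open>F\<close> is what
    permits it.\<close>
  also have "\<dots> = (\<Sum>F\<in>\<F>. (-1) ^ card F * int (card {\<sigma> \<in> level_perms V f. \<forall>(x, y)\<in>F. \<sigma> x = y}))"
  proof (intro sum.cong refl, goal_cases)
    case (1 F)
    then have "F \<subseteq> V \<times> V" "acyclic F" using B by (auto simp: \<F>_def)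
    moreover have "f v = f u" if "(u, v) \<in> F" for u v
      using 1 that by (auto simp: \<F>_def B_def)
    ultimately show ?case
      using card_listings_eq_card_perms[OF assms, of F f] by presburger
  qed
  also have "\<dots> = (\<Sum>F\<in>\<F>. \<Sum>\<sigma>\<in>level_perms V f. if \<forall>(x, y)\<in>F. \<sigma> x = y then (-1) ^ card F else 0)"
    using assms by (simp add: mult.commute flip: sum.inter_filter)
  also have "\<dots> = (\<Sum>\<sigma>\<in>level_perms V f. \<Sum>F\<in>\<F>. if \<forall>(x, y)\<in>F. \<sigma> x = y then (-1) ^ card F else 0)"
    by (rule sum.swap)
  also have "\<dots> = (\<Sum>\<sigma>\<in>level_perms V f. \<Prod>Q\<in>orbit \<sigma> ` V. orbit_sign A \<sigma> Q)"
  proof (intro sum.cong refl)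
    fix \<sigma> assume "\<sigma> \<in> level_perms V f"
    note alternating_sum_acyclic_subgraphs[OF assms this, of A, folded B_def]
    moreover have "(\<Sum>F\<in>\<F>. if \<forall>(x, y)\<in>F. \<sigma> x = y then (-1) ^ card F else 0) =
        (\<Sum>F | F \<subseteq> B \<and> acyclic F \<and> (\<forall>(x, y)\<in>F. \<sigma> x = y). (-1) ^ card F :: int)"
      unfolding sum.inter_filter[OF fin, symmetric] by (rule sum.cong) (auto simp: \<F>_def)
    ultimately show "(\<Sum>F\<in>\<F>. if \<forall>(x, y)\<in>F. \<sigma> x = y then (-1) ^ card F else 0) =
        (\<Prod>Q\<in>orbit \<sigma> ` V. orbit_sign A \<sigma> Q)" by presburger
  qed
  finally show ?thesis .
qed

section \<open>Cancellation by reversing a risky cycle\<close>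

definition flip_on :: "'a set \<Rightarrow> ('a \<Rightarrow> 'a) \<Rightarrow> 'a \<Rightarrow> 'a" where
  "flip_on Q \<sigma> x = (if x \<in> Q then inv \<sigma> x else \<sigma> x)"

context
  fixes V :: "'a set" and \<sigma> :: "'a \<Rightarrow> 'a" and Q :: "'a set"
  assumes fin: "finite V" and perm: "\<sigma> permutes V" and orb: "Q \<in> orbit \<sigma> ` V"
begin

lemma permutation_of_permutes: "permutation \<sigma>"
  using fin perm permutation_permutes by blast

lemma orbit_image_iff: "\<sigma> x \<in> Q \<longleftrightarrow> x \<in> Q"
proof -
  obtain z where z: "Q = orbit \<sigma> z" using orb by auto
  have "orbit \<sigma> (\<sigma> x) = orbit \<sigma> x" by (rule permutation_orbit_step[OF permutation_of_permutes])
  then show ?thesis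
    using z orbit_eq_if_mem[OF permutation_of_permutes]
      permutation_self_in_orbit[OF permutation_of_permutes]
    by metis
qed

lemma orbit_inv_image_iff: "inv \<sigma> x \<in> Q \<longleftrightarrow> x \<in> Q"
  using orbit_image_iff[of "inv \<sigma> x"] permutes_inverses(1)[OF perm] by simp

lemma orbit_subset_verts: "Q \<subseteq> V"
  using orb permutes_orbit_subset[OF perm] by auto

text \<open>\<open>Q\<close> is closed under \<sigma> and its inverse, so the flipped map sends
  \<open>Q\<close> and its complement into themselves and is injective on each.\<close>

lemma flip_on_permutes: "flip_on Q \<sigma> permutes V"
proof (rule bij_imp_permutes)
  have "flip_on Q \<sigma> x \<in> V" if "x \<in> V" for x
    using that permutes_in_image[OF perm] permutes_in_image[OF permutes_inv[OF perm]]
    by (simp add: flip_on_def)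
  moreover have "inj_on (flip_on Q \<sigma>) V"
  proof (rule inj_onI)
    fix x y assume eq: "flip_on Q \<sigma> x = flip_on Q \<sigma> y"
    have mem: "flip_on Q \<sigma> z \<in> Q \<longleftrightarrow> z \<in> Q" for z
      by (simp add: flip_on_def orbit_image_iff orbit_inv_image_iff)
    have "x \<in> Q \<longleftrightarrow> y \<in> Q" using mem[of x] mem[of y] eq by simp
    then show "x = y"
      using eq by (cases "x \<in> Q")
        (simp_all add: flip_on_def inj_eq[OF permutes_inj[OF perm]]
          inj_eq[OF permutes_inj[OF permutes_inv[OF perm]]])
  qed
  ultimately show "bij_betw (flip_on Q \<sigma>) V V"
    using fin by (simp add: bij_betw_def endo_inj_surj image_subset_iff)
next
  fix x assume "x \<notin> V"
  then show "flip_on Q \<sigma> x = x"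
    using orbit_subset_verts permutes_not_in[OF perm] by (auto simp: flip_on_def)
qed

text \<open>On \<open>Q\<close> the flipped map is the inverse of \<sigma>, which has the same
  orbits; off \<open>Q\<close> it is \<sigma> itself. Neither part leaves its side.\<close>

lemma orbit_flip_on: "orbit (flip_on Q \<sigma>) x = orbit \<sigma> x"
proof (cases "x \<in> Q")
  case True
  then have "orbit \<sigma> x = Q"
    using orb orbit_eq_if_mem[OF permutation_of_permutes] by auto
  moreover have "orbit (flip_on Q \<sigma>) x = orbit (inv \<sigma>) x"
    by (rule orbit_cong0[symmetric, where A = Q])
      (use True in \<open>auto simp: orbit_inv_image_iff flip_on_def\<close>)
  ultimately show ?thesis by (simp add: orbit_inv_eq[OF permutation_of_permutes])
next
  case False
  then show ?thesis
    by (intro orbit_cong0[symmetric, where A = "- Q"])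
      (auto simp: orbit_image_iff flip_on_def)
qed

lemma flip_on_flip_on: "flip_on Q (flip_on Q \<sigma>) = \<sigma>"
proof
  fix x
  have "inv (flip_on Q \<sigma>) x = \<sigma> x" if "x \<in> Q"
  proof -
    have "flip_on Q \<sigma> (\<sigma> x) = x"
      using that by (simp add: flip_on_def orbit_image_iff permutes_inverses(2)[OF perm])
    then show ?thesis using permutes_inv_eq[OF flip_on_permutes] by simp
  qed
  then show "flip_on Q (flip_on Q \<sigma>) x = \<sigma> x"
    by (auto simp: flip_on_def)
qed

lemma flip_on_level:
  assumes "\<sigma> \<in> level_perms V f"
  shows "flip_on Q \<sigma> \<in> level_perms V f"
proof -
  have "f (flip_on Q \<sigma> x) = f x" if "x \<in> V" for x
  proof -
    have "inv \<sigma> x \<in> V" using permutes_in_image[OF permutes_inv[OF perm]] that by simp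
    then have "f (\<sigma> (inv \<sigma> x)) = f (inv \<sigma> x)" using assms by (auto simp: level_perms_def)
    then show ?thesis
      using assms that by (auto simp: flip_on_def level_perms_def permutes_inverses(1)[OF perm])
  qed
  then show ?thesis using flip_on_permutes by (simp add: level_perms_def)
qed

text \<open>The arc from \<open>x\<close> to \<open>inv \<sigma> x\<close> is the arc from
  \<open>\<sigma> y\<close> to \<open>y\<close> for \<open>y = inv \<sigma> x\<close>, and
  \<open>y\<close> runs through \<open>Q\<close> along with \<open>x\<close>.\<close>

lemma flip_on_forward_iff:
  "(\<forall>x\<in>Q. (x, flip_on Q \<sigma> x) \<in> A) \<longleftrightarrow> (\<forall>x\<in>Q. (\<sigma> x, x) \<in> A)"
proof -
  have "(x, inv \<sigma> x) \<in> A" if "\<forall>x\<in>Q. (\<sigma> x, x) \<in> A" "x \<in> Q" for x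
    using that orbit_inv_image_iff[of x] permutes_inverses(1)[OF perm, of x] by force
  moreover have "(\<sigma> x, x) \<in> A" if "\<forall>x\<in>Q. (x, inv \<sigma> x) \<in> A" "x \<in> Q" for x
    using that orbit_image_iff[of x] permutes_inverses(2)[OF perm, of x] by force
  ultimately show ?thesis by (auto simp: flip_on_def)
qed

lemma flip_on_backward_iff:
  "(\<forall>x\<in>Q. (flip_on Q \<sigma> x, x) \<in> A) \<longleftrightarrow> (\<forall>x\<in>Q. (x, \<sigma> x) \<in> A)"
  using flip_on_forward_iff[of "A\<inverse>"] by simp

end

section \<open>Risky orbits and the sign-reversing involution\<close>

definition risky_orbit :: "('a \<times> 'a) set \<Rightarrow> ('a \<Rightarrow> 'a) \<Rightarrow> 'a set \<Rightarrow> bool" where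
  "risky_orbit A \<sigma> Q \<longleftrightarrow>
    even (card Q) \<and> ((\<forall>x\<in>Q. (x, \<sigma> x) \<in> A) \<or> (\<forall>x\<in>Q. (\<sigma> x, x) \<in> A))"

text \<open>Without antiparallel arcs, one direction of the cycle runs inside \<open>A\<close> and
  the other avoids \<open>A\<close> entirely. As the length is even, the two signs are -1 and
  1.\<close>

lemma orbit_sign_flip_on:
  assumes "finite V" "\<sigma> permutes V" "Q \<in> orbit \<sigma> ` V" "risky_orbit A \<sigma> Q"
    and antisym: "\<And>u v. (u, v) \<in> A \<Longrightarrow> (v, u) \<in> A \<Longrightarrow> u = v"
  shows "orbit_sign A (flip_on Q \<sigma>) Q = - orbit_sign A \<sigma> Q"
proof -
  have ev: "even (card Q)" using assms by (simp add: risky_orbit_def)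
  obtain z where z: "Q = orbit \<sigma> z" using assms by auto
  have perm: "permutation \<sigma>" using assms permutation_permutes by blast
  \<comment> \<open>Even size excludes fixed points. A loop is its own reversal and is not forbidden
    by \<open>antisym\<close>.\<close>
  have ne: "\<sigma> x \<noteq> x" if "x \<in> Q" for x
  proof
    assume "\<sigma> x = x"
    then have "orbit \<sigma> x = {x}" by (simp add: orbit_eq_singleton_iff)
    moreover have "orbit \<sigma> x = Q" using z that orbit_eq_if_mem[OF perm] by simp
    ultimately show False using ev by auto
  qed
  have anti: "\<not> ((x, \<sigma> x) \<in> A \<and> (\<sigma> x, x) \<in> A)" if "x \<in> Q" for x
    using antisym ne[OF that] by metis
  have "Q \<noteq> {}" using z by (simp add: orbit_nonempty)
  have fwd: "(\<forall>x\<in>Q. (x, flip_on Q \<sigma> x) \<in> B) \<longleftrightarrow> (\<forall>x\<in>Q. (\<sigma> x, x) \<in> B)" for B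
    using flip_on_forward_iff[OF assms(1-3)] .
  have neg: "(\<forall>x\<in>Q. (x, flip_on Q \<sigma> x) \<notin> A) \<longleftrightarrow> (\<forall>x\<in>Q. (\<sigma> x, x) \<notin> A)"
    using fwd[of "- A"] by simp
  consider "\<forall>x\<in>Q. (x, \<sigma> x) \<in> A" | "\<forall>x\<in>Q. (\<sigma> x, x) \<in> A"
    using assms by (auto simp: risky_orbit_def)
  then show ?thesis
  proof cases
    case 1
    then have "\<forall>x\<in>Q. (\<sigma> x, x) \<notin> A" using anti by blast
    moreover from this have "\<not> (\<forall>x\<in>Q. (\<sigma> x, x) \<in> A)" using \<open>Q \<noteq> {}\<close> by blast
    ultimately show ?thesis unfolding orbit_sign_def fwd neg using 1 ev by simp
  next
    case 2
    then have "\<forall>x\<in>Q. (x, \<sigma> x) \<notin> A" using anti by blast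
    moreover from this have "\<not> (\<forall>x\<in>Q. (x, \<sigma> x) \<in> A)" using \<open>Q \<noteq> {}\<close> by blast
    ultimately show ?thesis unfolding orbit_sign_def fwd neg using 2 ev by simp
  qed
qed

lemma flip_on_other_orbit:
  assumes "finite V" "\<sigma> permutes V" "Q \<in> orbit \<sigma> ` V" "R \<in> orbit \<sigma> ` V" "R \<noteq> Q" "x \<in> R"
  shows "flip_on Q \<sigma> x = \<sigma> x"
proof -
  have "permutation \<sigma>" using assms permutation_permutes by blast
  from disjoint_orbits[OF this, of V] have "R \<inter> Q = {}"
    using assms by (metis disjointD)
  then show ?thesis using assms(6) by (auto simp: flip_on_def)
qed

text \<open>Reversing \<open>Q\<close> swaps the two alternatives of riskiness for \<open>Q\<close>
  and leaves \<sigma> unchanged on every other orbit.\<close>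

lemma risky_orbit_flip_on:
  assumes "finite V" "\<sigma> permutes V" "Q \<in> orbit \<sigma> ` V" "R \<in> orbit \<sigma> ` V"
  shows "risky_orbit A (flip_on Q \<sigma>) R \<longleftrightarrow> risky_orbit A \<sigma> R"
proof (cases "R = Q")
  case True
  then show ?thesis
    using flip_on_forward_iff[OF assms(1-3), of A] flip_on_backward_iff[OF assms(1-3), of A]
    by (auto simp: risky_orbit_def)
next
  case False
  then show ?thesis
    using flip_on_other_orbit[OF assms False] by (simp add: risky_orbit_def)
qed

text \<open>The index set of the claimed power sum expansion, phrased with orbits instead of
  rotation classes; \<open>safe_perms_eq\<close> identifies the two.\<close>

definition safe_perms :: "('a \<times> 'a) set \<Rightarrow> 'a set \<Rightarrow> ('a \<Rightarrow> 'a) set" where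
  "safe_perms A V = {\<sigma>. \<sigma> permutes V \<and> (\<forall>Q\<in>orbit \<sigma> ` V.
    ((\<forall>x\<in>Q. (x, \<sigma> x) \<in> A) \<or> (\<forall>x\<in>Q. (x, \<sigma> x) \<notin> A)) \<and> \<not> risky_orbit A \<sigma> Q)}"

text \<open>Reversing a chosen risky orbit is a sign-reversing involution on the permutations that
  have one. The others have weight 1 if every orbit runs entirely inside or entirely outside
  \<open>A\<close>, and weight 0 otherwise.\<close>

lemma sum_signs_eq_card_safe_perms:
  assumes V: "finite V" and antisym: "\<And>u v. (u, v) \<in> A \<Longrightarrow> (v, u) \<in> A \<Longrightarrow> u = v"
  shows "(\<Sum>\<sigma>\<in>level_perms V f. \<Prod>Q\<in>orbit \<sigma> ` V. orbit_sign A \<sigma> Q) =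
    int (card (level_perms V f \<inter> safe_perms A V))"
proof -
  let ?h = "\<lambda>\<sigma>. \<Prod>Q\<in>orbit \<sigma> ` V. orbit_sign A \<sigma> Q"
  define R where "R \<sigma> = {Q \<in> orbit \<sigma> ` V. risky_orbit A \<sigma> Q}" for \<sigma>
  \<comment> \<open>The choice depends on \<sigma> only through \<open>R \<sigma>\<close>, which a
    reversal preserves, so the second reversal undoes the first.\<close>
  define c where "c \<sigma> = (SOME Q. Q \<in> R \<sigma>)" for \<sigma>
  define X where "X = {\<sigma> \<in> level_perms V f. R \<sigma> \<noteq> {}}"
  define Y where "Y = {\<sigma> \<in> level_perms V f. R \<sigma> = {}}"
  let ?flip = "\<lambda>\<sigma>. flip_on (c \<sigma>) \<sigma>"
  have flip: "?flip \<sigma> \<in> X \<and> ?flip (?flip \<sigma>) = \<sigma> \<and> ?h (?flip \<sigma>) = - ?h \<sigma>" if "\<sigma> \<in> X" for \<sigma>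
  proof -
    have p: "\<sigma> permutes V" and lev: "\<sigma> \<in> level_perms V f"
      using that by (auto simp: X_def level_perms_def)
    have "R \<sigma> \<noteq> {}" using that by (simp add: X_def)
    then have "c \<sigma> \<in> R \<sigma>" unfolding c_def by (rule some_in_eq[THEN iffD2])
    then have c: "c \<sigma> \<in> orbit \<sigma> ` V" "risky_orbit A \<sigma> (c \<sigma>)" by (auto simp: R_def)
    have orb: "orbit (?flip \<sigma>) ` V = orbit \<sigma> ` V"
      by (simp add: orbit_flip_on[OF V p c(1)])
    have "R (?flip \<sigma>) = R \<sigma>"
      unfolding R_def orb using risky_orbit_flip_on[OF V p c(1)] by auto
    then have "c (?flip \<sigma>) = c \<sigma>" "R (?flip \<sigma>) \<noteq> {}"
      using \<open>R \<sigma> \<noteq> {}\<close> by (auto simp: c_def)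
    then have "?flip \<sigma> \<in> X" "?flip (?flip \<sigma>) = \<sigma>"
      using flip_on_level[OF V p c(1) lev] flip_on_flip_on[OF V p c(1)] by (simp_all add: X_def)
    moreover have "?h (?flip \<sigma>) = - ?h \<sigma>"
    proof -
      have "(\<Prod>Q\<in>orbit \<sigma> ` V - {c \<sigma>}. orbit_sign A (?flip \<sigma>) Q) =
          (\<Prod>Q\<in>orbit \<sigma> ` V - {c \<sigma>}. orbit_sign A \<sigma> Q)"
        by (intro prod.cong refl orbit_sign_cong flip_on_other_orbit[OF V p c(1)]) auto
      then show ?thesis
        unfolding orb using V c(1) orbit_sign_flip_on[OF V p c antisym]
        by (simp add: prod.remove[of _ "c \<sigma>"])
    qed
    ultimately show ?thesis by blast
  qed
  have "(\<Sum>\<sigma>\<in>X. ?h \<sigma>) = (\<Sum>\<sigma>\<in>X. - ?h \<sigma>)"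
    by (rule sum.reindex_bij_witness[where i = ?flip and j = ?flip]) (use flip in auto)
  then have X: "(\<Sum>\<sigma>\<in>X. ?h \<sigma>) = 0" by (simp add: sum_negf)
  have Y: "?h \<sigma> = (if \<sigma> \<in> safe_perms A V then 1 else 0)" if "\<sigma> \<in> Y" for \<sigma>
  proof -
    have p: "\<sigma> permutes V" using that by (auto simp: Y_def level_perms_def)
    have nr: "\<not> risky_orbit A \<sigma> Q" if "Q \<in> orbit \<sigma> ` V" for Q
      using \<open>\<sigma> \<in> Y\<close> that by (auto simp: Y_def R_def)
    \<comment> \<open>An orbit that runs inside \<open>A\<close> and is not risky has odd size, so
      its sign is 1.\<close>
    have s: "orbit_sign A \<sigma> Q = (if (\<forall>x\<in>Q. (x, \<sigma> x) \<in> A) \<or> (\<forall>x\<in>Q. (x, \<sigma> x) \<notin> A) then 1 else 0)"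
      if "Q \<in> orbit \<sigma> ` V" for Q
      using nr[OF that] by (auto simp: orbit_sign_def risky_orbit_def)
    show ?thesis
    proof (cases "\<sigma> \<in> safe_perms A V")
      case True
      then have "orbit_sign A \<sigma> Q = 1" if "Q \<in> orbit \<sigma> ` V" for Q
        unfolding s[OF that] using that by (auto simp: safe_perms_def)
      then show ?thesis using True by simp
    next
      case False
      then obtain Q where Q: "Q \<in> orbit \<sigma> ` V" "\<not> ((\<forall>x\<in>Q. (x, \<sigma> x) \<in> A) \<or> (\<forall>x\<in>Q. (x, \<sigma> x) \<notin> A))"
        using p nr unfolding safe_perms_def by blast
      then have "orbit_sign A \<sigma> Q = 0" using s[OF Q(1)] by simp
      then show ?thesis using False Q(1) V by (auto simp: prod_zero_iff)
    qed
  qed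
  have "level_perms V f = X \<union> Y" "X \<inter> Y = {}" by (auto simp: X_def Y_def)
  moreover have "finite X" "finite Y" using V by (auto simp: X_def Y_def)
  ultimately have "(\<Sum>\<sigma>\<in>level_perms V f. ?h \<sigma>) = (\<Sum>\<sigma>\<in>Y. ?h \<sigma>)"
    using X by (simp add: sum.union_disjoint)
  also have "\<dots> = (\<Sum>\<sigma>\<in>Y. if \<sigma> \<in> safe_perms A V then 1 else 0)"
    using Y by (rule sum.cong[OF refl])
  also have "\<dots> = int (card {\<sigma> \<in> Y. \<sigma> \<in> safe_perms A V})"
    using \<open>finite Y\<close> by (simp flip: sum.inter_filter)
  also have "{\<sigma> \<in> Y. \<sigma> \<in> safe_perms A V} = level_perms V f \<inter> safe_perms A V"
    by (auto simp: Y_def R_def safe_perms_def)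
  finally show ?thesis .
qed

section \<open>Coefficients\<close>

lemma mcoeff_zero [simp]: "mcoeff 0 m = 0"
  by (simp add: zero_mfps.rep_eq)

lemma mcoeff_sum: "mcoeff (\<Sum>x\<in>S. F x) m = (\<Sum>x\<in>S. mcoeff (F x) m)"
  by (induction S rule: infinite_finite_induct) (simp_all add: plus_mfps.rep_eq)

text \<open>The case of infinitely many \<open>i\<close> is included: there both the sum and
  \<open>card\<close> default to 0.\<close>

lemma mcoeff_msum_indicator:
  assumes "\<And>i. i \<in> S \<Longrightarrow> mcoeff (F i) m = (if P i then 1 else 0)"
  shows "mcoeff (msum F S) m = of_nat (card {i \<in> S. P i})"
proof -
  have "{i \<in> S. mcoeff (F i) m \<noteq> 0} = {i \<in> S. P i}" using assms by (auto split: if_splits)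
  then have "mcoeff (msum F S) m = (\<Sum>i\<in>{i \<in> S. P i}. mcoeff (F i) m)"
    by (simp add: msum.rep_eq)
  also have "\<dots> = (\<Sum>i\<in>{i \<in> S. P i}. 1)" using assms by (intro sum.cong) auto
  finally show ?thesis by simp
qed

lemma mcoeff_fundamental:
  "mcoeff (fundamental I n) m = int (card {is \<in> fundamental_indices I n. mset is = m})"
  unfolding fundamental_def by (rule mcoeff_msum_indicator) (auto simp: mcoeff_prod_mvar)

lemma mcoeff_powersum:
  "mcoeff (powersum k) m = int (card {i \<in> {1..}. replicate_mset k i = m})"
  unfolding powersum_def
proof (rule mcoeff_msum_indicator)
  fix i
  show "mcoeff (mvar i ^ k :: (nat, int) mfps) m = (if replicate_mset k i = m then 1 else 0)"
    using mcoeff_prod_mvar[of "replicate k i" m]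
    by (auto simp: map_replicate prod_list_replicate)
qed

section \<open>Double counting of listings and labellings\<close>

lemma sum_card_swap:
  assumes "finite X" "finite Y"
  shows "(\<Sum>a\<in>X. card {b \<in> Y. R a b}) = (\<Sum>b\<in>Y. card {a \<in> X. R a b})"
proof -
  have "(\<Sum>a\<in>X. card {b \<in> Y. R a b}) = (\<Sum>a\<in>X. \<Sum>b\<in>Y. if R a b then 1 else 0)"
    using assms by (simp flip: sum.inter_filter)
  also have "\<dots> = (\<Sum>b\<in>Y. \<Sum>a\<in>X. if R a b then 1 else 0)" by (rule sum.swap)
  also have "\<dots> = (\<Sum>b\<in>Y. card {a \<in> X. R a b})"
    using assms by (simp flip: sum.inter_filter)
  finally show ?thesis .
qed

text \<open>Labellings are extensional, so each is determined by its values on \<open>V\<close> and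
  is counted once. The multiset \<open>m\<close> is the monomial that the labelling contributes
  to.\<close>

definition labelings :: "'a set \<Rightarrow> nat multiset \<Rightarrow> ('a \<Rightarrow> nat) set" where
  "labelings V m = {f \<in> V \<rightarrow>\<^sub>E {1..}. image_mset f (mset_set V) = m}"

lemma finite_labelings:
  assumes "finite V"
  shows "finite (labelings V m)"
proof (rule finite_subset)
  show "labelings V m \<subseteq> V \<rightarrow>\<^sub>E set_mset m"
    using assms by (auto simp: labelings_def PiE_iff extensional_def)
  show "finite (V \<rightarrow>\<^sub>E set_mset m)" using assms by (simp add: finite_PiE)
qed

text \<open>In a weakly increasing sequence a strict step is the same as two unequal consecutive
  labels, so the condition at the descents says that no arc of \<open>D\<close> in the listing joins
  equal labels.\<close>

lemma map_mem_fundamental_indices_iff: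
  assumes "set w = V" "length w = n"
  shows "map f w \<in> fundamental_indices (Des w D) n \<longleftrightarrow>
    (\<forall>x\<in>V. 1 \<le> f x) \<and> sorted (map f w) \<and> (\<forall>(u, v)\<in>list_arcs w. (u, v) \<in> parcs D \<longrightarrow> f u \<noteq> f v)"
proof -
  have "(\<forall>p\<in>Des w D. map f w ! (p - 1) < map f w ! p) \<longleftrightarrow>
      (\<forall>(u, v)\<in>list_arcs w. (u, v) \<in> parcs D \<longrightarrow> f u \<noteq> f v)" if s: "sorted (map f w)"
  proof -
    have le: "f (w ! i) \<le> f (w ! Suc i)" if "Suc i < length w" for i
      using sorted_nth_mono[OF s, of i "Suc i"] that by simp
    \<comment> \<open>Descents are numbered from 1: the descent \<open>Suc i\<close> concerns the
      list positions \<open>i\<close> and \<open>Suc i\<close>.\<close>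
    have "(\<forall>p\<in>Des w D. map f w ! (p - 1) < map f w ! p) \<longleftrightarrow>
        (\<forall>i. Suc i < length w \<longrightarrow> (w ! i, w ! Suc i) \<in> parcs D \<longrightarrow> f (w ! i) < f (w ! Suc i))"
    proof (intro iffI allI impI ballI)
      fix i assume *: "\<forall>p\<in>Des w D. map f w ! (p - 1) < map f w ! p"
        "Suc i < length w" "(w ! i, w ! Suc i) \<in> parcs D"
      then have "Suc i \<in> Des w D" by (auto simp: Des_def)
      with * show "f (w ! i) < f (w ! Suc i)" by fastforce
    next
      fix p assume *: "\<forall>i. Suc i < length w \<longrightarrow> (w ! i, w ! Suc i) \<in> parcs D \<longrightarrow> f (w ! i) < f (w ! Suc i)"
        "p \<in> Des w D"
      then obtain i where "p = Suc i" by (cases p) (auto simp: Des_def)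
      with * show "map f w ! (p - 1) < map f w ! p" by (auto simp: Des_def)
    qed
    also have "\<dots> \<longleftrightarrow> (\<forall>(u, v)\<in>list_arcs w. (u, v) \<in> parcs D \<longrightarrow> f u \<noteq> f v)"
      using le by (fastforce simp: list_arcs_iff order.strict_iff_order)
    finally show ?thesis .
  qed
  then show ?thesis
    using assms by (auto simp: fundamental_indices_def)
qed

text \<open>Reading the labels along \<open>w\<close> is a bijection from labellings to index
  tuples.\<close>

lemma card_fundamental_indices_eq:
  assumes V: "finite V" and w: "w \<in> permutations_of_set V"
  shows "card {is \<in> fundamental_indices (Des w D) (card V). mset is = m} =
    card {f \<in> labelings V m. sorted (map f w) \<and>
      (\<forall>(u, v)\<in>list_arcs w. (u, v) \<in> parcs D \<longrightarrow> f u \<noteq> f v)}" (is "card ?L = card ?R")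
proof -
  have dw: "distinct w" "set w = V" using w by (auto simp: permutations_of_set_def)
  then have len: "length w = card V" using distinct_card by fastforce
  have msw: "mset_set V = mset w" using dw by (metis mset_set_set)
  have "bij_betw (\<lambda>f. map f w) ?R ?L"
    unfolding bij_betw_def
  proof (intro conjI subset_antisym subsetI)
    show "inj_on (\<lambda>f. map f w) ?R"
    proof (rule inj_onI)
      fix f g assume "f \<in> ?R" "g \<in> ?R" "map f w = map g w"
      then show "f = g"
        using dw by (intro extensionalityI[of _ V]) (auto simp: labelings_def PiE_iff)
    qed
  next
    fix "is" assume "is \<in> (\<lambda>f. map f w) ` ?R"
    then obtain f where f: "is = map f w" "f \<in> labelings V m" "sorted (map f w)"
      "\<forall>(u, v)\<in>list_arcs w. (u, v) \<in> parcs D \<longrightarrow> f u \<noteq> f v" by blast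
    moreover have "mset is = m" using f by (auto simp: labelings_def msw)
    moreover have "\<forall>x\<in>V. 1 \<le> f x" using f(2) by (auto simp: labelings_def PiE_iff)
    ultimately show "is \<in> ?L"
      using map_mem_fundamental_indices_iff[OF dw(2) len, of f D] by simp
  next
    fix "is" assume L: "is \<in> ?L"
    then have "length is = length w" by (simp add: fundamental_indices_def len)
    define f where "f = (\<lambda>x\<in>V. the (map_of (zip w is) x))"
    have "map f w = is"
      using dw \<open>length is = length w\<close>
      by (intro nth_equalityI) (auto simp: f_def map_of_zip_nth)
    moreover from this L have "\<forall>x\<in>V. 1 \<le> f x" "sorted (map f w)"
      "\<forall>(u, v)\<in>list_arcs w. (u, v) \<in> parcs D \<longrightarrow> f u \<noteq> f v"
      using map_mem_fundamental_indices_iff[OF dw(2) len, of f D] by auto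
    moreover have "f \<in> labelings V m"
      using calculation L by (auto simp: labelings_def PiE_iff msw f_def simp flip: mset_map)
    ultimately show "is \<in> (\<lambda>f. map f w) ` ?R" by blast
  qed
  then show ?thesis by (simp add: bij_betw_same_card)
qed

text \<open>The coefficient counts compatible pairs of a listing and a labelling. For each
  labelling, compatible listings are as numerous as safe permutations that preserve it; these pairs
  are then counted by permutation.\<close>

lemma mcoeff_redei_berge:
  assumes V: "finite (pverts D)"
    and antisym: "\<And>u v. (u, v) \<in> parcs D \<Longrightarrow> (v, u) \<in> parcs D \<Longrightarrow> u = v"
  shows "mcoeff (redei_berge D) m =
    (\<Sum>\<sigma>\<in>safe_perms (parcs D) (pverts D).
      int (card {f \<in> labelings (pverts D) m. \<forall>x\<in>pverts D. f (\<sigma> x) = f x}))"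
proof -
  let ?V = "pverts D"
  let ?C = "\<lambda>w f. sorted (map f w) \<and> (\<forall>(u, v)\<in>list_arcs w. (u, v) \<in> parcs D \<longrightarrow> f u \<noteq> f v)"
  have fin: "finite (labelings ?V m)" using V by (rule finite_labelings)
  have finS: "finite (safe_perms (parcs D) ?V)"
    using finite_permutations[OF V] by (auto simp: safe_perms_def)
  have "mcoeff (redei_berge D) m =
      int (\<Sum>w\<in>permutations_of_set ?V. card {f \<in> labelings ?V m. ?C w f})"
    unfolding redei_berge_def mcoeff_sum mcoeff_fundamental of_nat_sum
    by (intro sum.cong refl arg_cong[where f = int] card_fundamental_indices_eq V)
  also have "\<dots> = (\<Sum>f\<in>labelings ?V m. int (card {w \<in> permutations_of_set ?V. ?C w f}))"
    using fin by (subst sum_card_swap) simp_all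
  also have "\<dots> = (\<Sum>f\<in>labelings ?V m. int (card {\<sigma> \<in> safe_perms (parcs D) ?V. \<forall>x\<in>?V. f (\<sigma> x) = f x}))"
  proof (intro sum.cong refl)
    fix f
    have "{w \<in> permutations_of_set ?V. ?C w f} =
        {w \<in> sorted_listings ?V f. \<forall>(u, v)\<in>list_arcs w. (u, v) \<in> parcs D \<longrightarrow> f u \<noteq> f v}"
      by (auto simp: sorted_listings_def)
    moreover have "level_perms ?V f \<inter> safe_perms (parcs D) ?V =
        {\<sigma> \<in> safe_perms (parcs D) ?V. \<forall>x\<in>?V. f (\<sigma> x) = f x}"
      by (auto simp: level_perms_def safe_perms_def)
    ultimately show "int (card {w \<in> permutations_of_set ?V. ?C w f}) =
        int (card {\<sigma> \<in> safe_perms (parcs D) ?V. \<forall>x\<in>?V. f (\<sigma> x) = f x})"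
      using card_compatible_listings[OF V, of f "parcs D"]
        sum_signs_eq_card_safe_perms[OF V antisym, of "parcs D" f] by presburger
  qed
  also have "\<dots> = int (\<Sum>\<sigma>\<in>safe_perms (parcs D) ?V. card {f \<in> labelings ?V m. \<forall>x\<in>?V. f (\<sigma> x) = f x})"
    using sum_card_swap[OF fin finS, of "\<lambda>f \<sigma>. \<forall>x\<in>?V. f (\<sigma> x) = f x"]
    by (simp flip: of_nat_sum)
  finally show ?thesis by simp
qed

section \<open>Coefficients of products of power sums\<close>

lemma image_mset_const_on:
  assumes "finite Q" "\<And>x. x \<in> Q \<Longrightarrow> f x = c"
  shows "image_mset f (mset_set Q) = replicate_mset (card Q) c"
proof -
  have "image_mset f (mset_set Q) = image_mset (\<lambda>_. c) (mset_set Q)"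
    using assms by (intro image_mset_cong) auto
  then show ?thesis by (simp add: image_mset_const_eq)
qed

text \<open>A term of the factor for \<open>Q\<close> is the choice of one label, used
  \<open>card Q\<close> times. Choosing a term in each factor therefore amounts to a labelling that
  is constant on every block.\<close>

lemma mcoeff_prod_powersum:
  assumes "finite \<Q>" "\<And>Q. Q \<in> \<Q> \<Longrightarrow> finite Q \<and> Q \<noteq> {}" "disjoint \<Q>"
  shows "mcoeff (\<Prod>Q\<in>\<Q>. powersum (card Q)) m =
    int (card {f \<in> labelings (\<Union>\<Q>) m. \<forall>Q\<in>\<Q>. \<forall>x\<in>Q. \<forall>y\<in>Q. f x = f y})"
  using assms
proof (induction \<Q> arbitrary: m rule: finite_induct)
  case empty
  \<comment> \<open>Extensionality leaves a single function on the empty domain, and its content is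
    the empty multiset.\<close>
  have "labelings ({} :: 'a set) m = (if m = {#} then {\<lambda>_. undefined} else {})"
    by (auto simp: labelings_def)
  then show ?case by (simp add: one_mfps.rep_eq split: if_splits)
next
  case (insert Q \<Q>)
  let ?U = "\<Union>\<Q>"
  let ?S = "{(a, b). a + b = m}"
  \<comment> \<open>\<open>?I\<close> uses only the first and \<open>?G\<close> only the second
    component of the splitting \<open>p\<close>; both take the whole pair in order to serve as
    fibres over the same index.\<close>
  let ?I = "\<lambda>p. {i \<in> {1..}. replicate_mset (card Q) i = fst p}"
  let ?G = "\<lambda>p. {f \<in> labelings ?U (snd p). \<forall>Q\<in>\<Q>. \<forall>x\<in>Q. \<forall>y\<in>Q. f x = f y}"
  let ?H = "{f \<in> labelings (\<Union>(insert Q \<Q>)) m. \<forall>Q\<in>insert Q \<Q>. \<forall>x\<in>Q. \<forall>y\<in>Q. f x = f y}"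
  have disj: "Q \<inter> R = {}" if "R \<in> \<Q>" for R
    using insert.prems(2) insert.hyps(2) that by (auto simp: pairwise_insert disjnt_def)
  then have QU: "Q \<inter> ?U = {}" by blast
  have fin: "finite Q" "finite ?U" using insert by auto
  obtain q where q: "q \<in> Q" using insert.prems(1) by blast
  have msU: "mset_set (Q \<union> ?U) = mset_set Q + mset_set ?U"
    using fin QU by (rule mset_set_Union)
  have finI: "finite (?I p)" for p
  proof (rule finite_subset)
    have "card Q \<noteq> 0" using fin(1) q by auto
    show "?I p \<subseteq> set_mset (fst p)"
    proof
      fix i assume "i \<in> ?I p"
      then have "fst p = replicate_mset (card Q) i" by simp
      then show "i \<in> set_mset (fst p)" using \<open>card Q \<noteq> 0\<close> by simp
    qed
  qed simp
  have finG: "finite (?G p)" for p using finite_labelings[OF fin(2)] by simp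
  have IH: "mcoeff (\<Prod>Q\<in>\<Q>. powersum (card Q)) b = int (card (?G (a, b)))" for a b
    using insert.IH[of b] insert.prems by (simp add: pairwise_insert)
  have "mcoeff (\<Prod>Q\<in>insert Q \<Q>. powersum (card Q)) m =
      (\<Sum>p\<in>?S. int (card (?I p)) * int (card (?G p)))"
    using insert.hyps IH by (simp add: times_mfps.rep_eq mcoeff_powersum case_prod_unfold)
  also have "\<dots> = int (card (SIGMA p:?S. ?I p \<times> ?G p))"
  proof -
    have "card (SIGMA p:?S. ?I p \<times> ?G p) = (\<Sum>p\<in>?S. card (?I p \<times> ?G p))"
      by (rule card_SigmaI[OF finite_mset_splits]) (intro ballI finite_cartesian_product finI finG)
    then show ?thesis by (simp only: card_cartesian_product of_nat_sum of_nat_mult)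
  qed
  also have "card (SIGMA p:?S. ?I p \<times> ?G p) = card ?H"
  proof (rule bij_betw_same_card[OF bij_betw_byWitness])
    \<comment> \<open>\<open>?j\<close> glues a label for \<open>Q\<close> to a labelling of the
      other blocks. \<open>?i\<close> takes a labelling apart and reads the label of
      \<open>Q\<close> at the representative \<open>q\<close>.\<close>
    let ?j = "\<lambda>(p, i, f). (\<lambda>x. if x \<in> Q then i else f x)"
    let ?i = "\<lambda>f. ((replicate_mset (card Q) (f q), image_mset f (mset_set ?U)), f q, restrict f ?U)"
    have glue: "image_mset (\<lambda>x. if x \<in> Q then i else f x) (mset_set ?U) = image_mset f (mset_set ?U)"
      for i :: nat and f
      using QU fin(2) by (intro image_mset_cong) auto
    have restr: "image_mset (restrict f ?U) (mset_set ?U) = image_mset f (mset_set ?U)" for f :: "_ \<Rightarrow> nat"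
      using fin(2) by (intro image_mset_cong) auto
    show "\<forall>t\<in>SIGMA p:?S. ?I p \<times> ?G p. ?i (?j t) = t"
    proof
      fix t assume "t \<in> (SIGMA p:?S. ?I p \<times> ?G p)"
      then obtain a b i f where t: "t = ((a, b), i, f)" "a = replicate_mset (card Q) i"
        "f \<in> labelings ?U b" by auto
      have "restrict (\<lambda>x. if x \<in> Q then i else f x) ?U = f"
        using t(3) QU by (auto simp: fun_eq_iff restrict_def labelings_def PiE_iff extensional_def)
      moreover have "image_mset f (mset_set ?U) = b" using t(3) by (simp add: labelings_def)
      ultimately show "?i (?j t) = t" using t q by (simp add: glue)
    qed
    show "\<forall>f\<in>?H. ?j (?i f) = f"
    proof
      fix f assume f: "f \<in> ?H"
      then have "f x = f q" if "x \<in> Q" for x using q that by blast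
      moreover have "f x = undefined" if "x \<notin> Q" "x \<notin> ?U" for x
        using f that by (auto simp: labelings_def PiE_iff extensional_def)
      ultimately show "?j (?i f) = f" by (auto simp: fun_eq_iff)
    qed
    show "?j ` (SIGMA p:?S. ?I p \<times> ?G p) \<subseteq> ?H"
    proof (rule image_subsetI)
      fix t assume mem: "t \<in> (SIGMA p:?S. ?I p \<times> ?G p)"
      obtain a b i f where t: "t = ((a, b), i, f)" by (metis prod.exhaust)
      have "a + b = m" "i \<in> ?I (a, b)" "f \<in> ?G (a, b)" using mem unfolding t by blast+
      then have ab: "a + b = m" "a = replicate_mset (card Q) i" "1 \<le> i"
        and f: "f \<in> labelings ?U b" "\<And>R x y. R \<in> \<Q> \<Longrightarrow> x \<in> R \<Longrightarrow> y \<in> R \<Longrightarrow> f x = f y"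
        unfolding fst_conv snd_conv by blast+
      let ?g = "\<lambda>x. if x \<in> Q then i else f x"
      have "image_mset ?g (mset_set (Q \<union> ?U)) = m"
        unfolding msU image_mset_union glue using ab f(1)
        by (subst image_mset_const_on[of _ _ i]) (auto simp: labelings_def fin(1))
      then have "?g \<in> labelings (\<Union>(insert Q \<Q>)) m"
        using ab(3) f(1) by (auto simp: labelings_def PiE_iff extensional_def)
      moreover have "?g x = ?g y" if "R \<in> insert Q \<Q>" "x \<in> R" "y \<in> R" for R x y
      proof (cases "R = Q")
        case False
        then have "R \<in> \<Q>" "x \<notin> Q" "y \<notin> Q" using that disj by auto
        moreover have "f x = f y" by (rule f(2)[OF \<open>R \<in> \<Q>\<close> that(2,3)])
        ultimately show ?thesis by simp
      qed (use that in simp)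
      ultimately have "?g \<in> ?H" by blast
      then show "?j t \<in> ?H" unfolding t by (simp only: prod.case)
    qed
    show "?i ` ?H \<subseteq> (SIGMA p:?S. ?I p \<times> ?G p)"
    proof (rule image_subsetI)
      fix f assume "f \<in> ?H"
      then have f: "f \<in> labelings (\<Union>(insert Q \<Q>)) m"
        and const: "\<And>R x y. R \<in> insert Q \<Q> \<Longrightarrow> x \<in> R \<Longrightarrow> y \<in> R \<Longrightarrow> f x = f y"
        by blast+
      let ?a = "replicate_mset (card Q) (f q)" and ?b = "image_mset f (mset_set ?U)"
      have fq: "f x = f q" if "x \<in> Q" for x by (rule const[OF insertI1 that q])
      have "image_mset f (mset_set (Q \<union> ?U)) = m" using f by (simp add: labelings_def)
      moreover have "image_mset f (mset_set Q) = ?a"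
        by (rule image_mset_const_on[OF fin(1)]) (rule fq)
      ultimately have "?a + ?b = m" unfolding msU image_mset_union by (simp only:)
      moreover have "1 \<le> f q" using f q by (auto simp: labelings_def PiE_iff)
      then have "f q \<in> ?I (?a, ?b)" by simp
      moreover have "restrict f ?U \<in> ?G (?a, ?b)"
        unfolding snd_conv
      proof (intro CollectI conjI ballI)
        show "restrict f ?U \<in> labelings ?U ?b"
          using f restr by (auto simp: labelings_def PiE_iff)
        show "restrict f ?U x = restrict f ?U y" if "R \<in> \<Q>" "x \<in> R" "y \<in> R" for R x y
        proof -
          have "x \<in> ?U" "y \<in> ?U" using that by auto
          moreover have "f x = f y" by (rule const[OF insertI2[OF that(1)] that(2,3)])
          ultimately show ?thesis by (simp only: restrict_apply if_True)
        qed
      qed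
      ultimately show "?i f \<in> (SIGMA p:?S. ?I p \<times> ?G p)" by blast
    qed
  qed
  finally show ?case .
qed

lemma invariant_iff_constant_on_orbits:
  assumes "finite V" "\<sigma> permutes V"
  shows "(\<forall>x\<in>V. f (\<sigma> x) = f x) \<longleftrightarrow> (\<forall>Q\<in>orbit \<sigma> ` V. \<forall>x\<in>Q. \<forall>y\<in>Q. f x = f y)"
proof
  assume inv: "\<forall>x\<in>V. f (\<sigma> x) = f x"
  have "f y = f x" if "y \<in> orbit \<sigma> x" "x \<in> V" for x y
    using that
  proof induction
    case (step y)
    then have "y \<in> V" using permutes_orbit_subset[OF assms(2)] by blast
    with step inv show ?case by simp
  qed (use inv in simp)
  then show "\<forall>Q\<in>orbit \<sigma> ` V. \<forall>x\<in>Q. \<forall>y\<in>Q. f x = f y" by force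
next
  assume const: "\<forall>Q\<in>orbit \<sigma> ` V. \<forall>x\<in>Q. \<forall>y\<in>Q. f x = f y"
  have "permutation \<sigma>" using assms permutation_permutes by blast
  then have "x \<in> orbit \<sigma> x" "\<sigma> x \<in> orbit \<sigma> x" for x
    by (auto intro: permutation_self_in_orbit orbit.base)
  then show "\<forall>x\<in>V. f (\<sigma> x) = f x" using const by blast
qed

section \<open>Cycles and orbits\<close>

lemma rot_class_rotate:
  assumes "v \<noteq> []"
  shows "rot_class (rotate k v) = rot_class v"
proof -
  have "(v, rotate k v) \<in> rot_equiv" using assms by (auto simp: rot_equiv_def)
  then show ?thesis
    unfolding rot_class_def by (rule equiv_class_eq[OF equiv_rot_equiv, symmetric])
qed

lemma set_rot_rep_rot_class: "v \<noteq> [] \<Longrightarrow> set (rot_rep (rot_class v)) = set v"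
  using rot_rep_rot_class[of v] by (auto simp: rot_equiv_def)

context
  fixes \<sigma> :: "'a \<Rightarrow> 'a"
  assumes perm: "permutation \<sigma>"
begin

lemma support_nonempty: "support \<sigma> i \<noteq> []"
  using least_power_of_permutation(2)[OF perm, of i] by simp

lemma set_support: "set (support \<sigma> i) = orbit \<sigma> i"
  unfolding support_set[OF perm] orbit_altdef_permutation[OF perm] by auto

lemma length_support: "length (support \<sigma> i) = card (orbit \<sigma> i)"
  using distinct_card[OF cycle_of_permutation[OF perm, of i]] unfolding set_support by simp

lemma least_power_eq_card_orbit: "least_power \<sigma> i = card (orbit \<sigma> i)"
  using length_support[of i] by simp

text \<open>Both tuples have the size of the common orbit as length, and exponents of \<sigma> at
  \<open>i\<close> may be reduced modulo that size.\<close>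

lemma support_funpow: "support \<sigma> ((\<sigma> ^^ k) i) = rotate k (support \<sigma> i)"
proof -
  have "(\<sigma> ^^ k) i \<in> orbit \<sigma> i"
    by (rule funpow_in_orbit[OF permutation_self_in_orbit[OF perm]])
  then have L: "least_power \<sigma> ((\<sigma> ^^ k) i) = least_power \<sigma> i"
    unfolding least_power_eq_card_orbit by (simp add: orbit_eq_if_mem[OF perm])
  show ?thesis
  proof (rule nth_equalityI)
    fix n assume "n < length (support \<sigma> ((\<sigma> ^^ k) i))"
    then have n: "n < least_power \<sigma> i" by (simp add: L)
    have "(\<sigma> ^^ ((k + n) mod least_power \<sigma> i)) i = (\<sigma> ^^ (k + n)) i"
      using least_power_of_permutation[OF perm, of i] by (simp add: funpow_mod_eq)
    then show "support \<sigma> ((\<sigma> ^^ k) i) ! n = rotate k (support \<sigma> i) ! n"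
      using n by (simp add: L nth_rotate funpow_add add.commute[of k])
  qed (simp add: L)
qed

lemma rot_class_support_eq:
  assumes "orbit \<sigma> i = orbit \<sigma> j"
  shows "rot_class (support \<sigma> i) = rot_class (support \<sigma> j)"
proof -
  have "i \<in> orbit \<sigma> j" using assms permutation_self_in_orbit[OF perm] by blast
  then obtain k where i: "i = (\<sigma> ^^ k) j" unfolding orbit_altdef by blast
  show ?thesis unfolding i support_funpow by (rule rot_class_rotate[OF support_nonempty])
qed

lemma set_rot_rep_support: "set (rot_rep (rot_class (support \<sigma> i))) = orbit \<sigma> i"
  unfolding set_rot_rep_rot_class[OF support_nonempty] by (rule set_support)

text \<open>Taking the set of entries is a bijection from cycles to orbits: the orbit determines the
  cycle up to the choice of starting point, hence up to rotation.\<close>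

lemma prod_perm_cycles:
  fixes F :: "nat \<Rightarrow> 'b :: comm_monoid_mult"
  shows "(\<Prod>\<gamma>\<in>perm_cycles V \<sigma>. F (rot_length \<gamma>)) = (\<Prod>Q\<in>orbit \<sigma> ` V. F (card Q))"
proof (rule prod.reindex_cong[symmetric])
  show "inj_on (\<lambda>\<gamma>. set (rot_rep \<gamma>)) (perm_cycles V \<sigma>)"
    unfolding perm_cycles_def
    by (intro inj_onI) (clarsimp simp: set_rot_rep_support, erule rot_class_support_eq)
  show "orbit \<sigma> ` V = (\<lambda>\<gamma>. set (rot_rep \<gamma>)) ` perm_cycles V \<sigma>"
    unfolding perm_cycles_def by (simp add: image_image set_rot_rep_support)
  show "F (card (set (rot_rep \<gamma>))) = F (rot_length \<gamma>)" if "\<gamma> \<in> perm_cycles V \<sigma>" for \<gamma>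
    using that set_rot_rep_support rot_length_rot_class[OF support_nonempty] length_support
    unfolding perm_cycles_def by auto
qed

lemma rotate1_support: "rotate1 (support \<sigma> i) = map \<sigma> (support \<sigma> i)"
proof -
  have "rotate1 (support \<sigma> i) = support \<sigma> (\<sigma> i)"
    using support_funpow[of 1 i] by simp
  also have "\<dots> = map \<sigma> (support \<sigma> i)"
    unfolding least_power_eq_card_orbit permutation_orbit_step[OF perm]
    by (simp add: funpow_swap1)
  finally show ?thesis .
qed

lemma CArcs_support: "CArcs (rot_class (support \<sigma> i)) = (\<lambda>x. (x, \<sigma> x)) ` orbit \<sigma> i"
proof -
  have "zip xs (map \<sigma> xs) = map (\<lambda>x. (x, \<sigma> x)) xs" for xs by (induction xs) auto
  then show ?thesis
    unfolding CArcs_rot_class[OF support_nonempty] rotate1_support set_support[symmetric]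
    by (metis set_map)
qed

lemma CArcs_rev_support: "CArcs (rot_class (rev (support \<sigma> i))) = (\<lambda>x. (\<sigma> x, x)) ` orbit \<sigma> i"
proof -
  let ?s = "support \<sigma> i"
  \<comment> \<open>The representative \<open>rev (rotate1 ?s)\<close> is chosen because rotating it
    once gives \<open>rev ?s\<close>; its cyclic arcs thus come from zipping the reversals of
    \<open>map \<sigma> ?s\<close> and \<open>?s\<close>.\<close>
  have rr: "rotate1 (rev (rotate1 xs)) = rev xs" for xs :: "'a list" by (cases xs) auto
  have ne: "rev (rotate1 ?s) \<noteq> []" "rev ?s \<noteq> []" using support_nonempty[of i] by auto
  have "rot_class (rev ?s) = rot_class (rev (rotate1 ?s))"
    using rot_class_rotate[OF ne(1), of 1] rr[of ?s] by simp
  then have "CArcs (rot_class (rev ?s)) = set (zip (rev (rotate1 ?s)) (rev ?s))"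
    using CArcs_rot_class[OF ne(1)] rr[of ?s] by simp
  also have "\<dots> = set (zip (map \<sigma> ?s) ?s)"
    unfolding rotate1_support by (subst zip_rev) simp_all
  also have "zip (map \<sigma> xs) xs = map (\<lambda>x. (\<sigma> x, x)) xs" for xs by (induction xs) auto
  finally show ?thesis unfolding set_support[symmetric] by (metis set_map)
qed

end

section \<open>From orbits back to cycles, and the final identity\<close>

lemma powersum_partition_perm_type:
  assumes "finite V" "\<sigma> permutes V"
  shows "powersum_partition (perm_type V \<sigma>) = (\<Prod>Q\<in>orbit \<sigma> ` V. powersum (card Q))"
proof -
  have "permutation \<sigma>" using assms permutation_permutes by blast
  then show ?thesis
    unfolding powersum_partition_def perm_type_def
    by (simp add: prod_perm_cycles image_mset.compositionality comp_def flip: prod_unfold_prod_mset)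
qed

lemma mcoeff_powersum_partition_perm_type:
  assumes "finite V" "\<sigma> permutes V"
  shows "mcoeff (powersum_partition (perm_type V \<sigma>)) m =
    int (card {f \<in> labelings V m. \<forall>x\<in>V. f (\<sigma> x) = f x})"
proof -
  have perm: "permutation \<sigma>" using assms permutation_permutes by blast
  have "mcoeff (\<Prod>Q\<in>orbit \<sigma> ` V. powersum (card Q)) m =
      int (card {f \<in> labelings (\<Union>(orbit \<sigma> ` V)) m. \<forall>Q\<in>orbit \<sigma> ` V. \<forall>x\<in>Q. \<forall>y\<in>Q. f x = f y})"
    by (rule mcoeff_prod_powersum)
      (use assms(1) finite_orbit_permutation[OF perm] disjoint_orbits[OF perm]
        in \<open>auto simp: orbit_nonempty\<close>)
  then show ?thesis
    unfolding powersum_partition_perm_type[OF assms] Union_orbits[OF assms]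
      invariant_iff_constant_on_orbits[OF assms] .
qed

text \<open>The tuple of a cycle of \<sigma> is nonempty, distinct and inside the vertex set from
  the outset, so being a digraph cycle reduces to the condition on arcs. That condition can be
  checked point by point on the orbit.\<close>

lemma safe_perms_eq:
  assumes V: "finite (pverts D)"
  shows "{\<sigma> \<in> cycle_perms D. \<forall>\<gamma>\<in>perm_cycles (pverts D) \<sigma>. \<not> risky D \<gamma>} =
    safe_perms (parcs D) (pverts D)"
proof -
  have "(\<forall>\<gamma>\<in>perm_cycles (pverts D) \<sigma>.
        (is_digraph_cycle D \<gamma> \<or> is_digraph_cycle (complement_digraph D) \<gamma>) \<and> \<not> risky D \<gamma>) \<longleftrightarrow>
      (\<forall>Q\<in>orbit \<sigma> ` pverts D. ((\<forall>x\<in>Q. (x, \<sigma> x) \<in> parcs D) \<or> (\<forall>x\<in>Q. (x, \<sigma> x) \<notin> parcs D)) \<and>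
        \<not> risky_orbit (parcs D) \<sigma> Q)" if p: "\<sigma> permutes pverts D" for \<sigma>
  proof -
    have perm: "permutation \<sigma>" using V p permutation_permutes by blast
    let ?\<gamma> = "\<lambda>i. rot_class (support \<sigma> i)"
    have sub: "orbit \<sigma> i \<subseteq> pverts D" if "i \<in> pverts D" for i
      using permutes_orbit_subset[OF p that] .
    have cyc: "is_digraph_cycle G (?\<gamma> i) \<longleftrightarrow> (\<forall>x\<in>orbit \<sigma> i. (x, \<sigma> x) \<in> parcs G)"
      if "i \<in> pverts D" "pverts G = pverts D" for i G
    proof -
      have "support \<sigma> i \<noteq> [] \<and> distinct (support \<sigma> i) \<and> set (support \<sigma> i) \<subseteq> pverts G"
        using support_nonempty[OF perm] cycle_of_permutation[OF perm] set_support[OF perm] sub that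
        by metis
      then show ?thesis unfolding is_digraph_cycle_def CArcs_support[OF perm] by blast
    qed
    have rev: "is_digraph_cycle D (rot_reversal (?\<gamma> i)) \<longleftrightarrow> (\<forall>x\<in>orbit \<sigma> i. (\<sigma> x, x) \<in> parcs D)"
      if "i \<in> pverts D" for i
    proof -
      have "rev (support \<sigma> i) \<noteq> [] \<and> distinct (rev (support \<sigma> i)) \<and> set (rev (support \<sigma> i)) \<subseteq> pverts D"
        using support_nonempty[OF perm] cycle_of_permutation[OF perm] set_support[OF perm] sub that
        by (metis distinct_rev rev_is_Nil_conv set_rev)
      then show ?thesis
        unfolding rot_reversal_rot_class[OF support_nonempty[OF perm]] is_digraph_cycle_def
          CArcs_rev_support[OF perm] by blast
    qed
    \<comment> \<open>The pairs \<open>(x, \<sigma> x)\<close> stay inside the vertex set, so being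
      an arc of the complement means not being an arc of \<open>D\<close>.\<close>
    have comp: "is_digraph_cycle (complement_digraph D) (?\<gamma> i) \<longleftrightarrow>
        (\<forall>x\<in>orbit \<sigma> i. (x, \<sigma> x) \<notin> parcs D)" if "i \<in> pverts D" for i
      using cyc[OF that, of "complement_digraph D"] sub[OF that] permutes_in_image[OF p]
      by (auto simp: complement_digraph_def)
    have "risky D (?\<gamma> i) \<longleftrightarrow> risky_orbit (parcs D) \<sigma> (orbit \<sigma> i)" if "i \<in> pverts D" for i
      unfolding risky_def risky_orbit_def rot_length_rot_class[OF support_nonempty[OF perm]]
        length_support[OF perm] cyc[OF that refl] rev[OF that] ..
    then show ?thesis
      unfolding perm_cycles_def by (simp add: cyc comp)
  qed
  then show ?thesis unfolding cycle_perms_def safe_perms_def by blast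
qed

lemma powersum_partition_mem_powersum_semiring:
  "\<forall>k\<in>#la. 1 \<le> k \<Longrightarrow> powersum_partition la \<in> powersum_semiring"
  unfolding powersum_partition_def
  by (induction la) (auto intro: powersum_semiring.intros simp del: One_nat_def)

lemma sum_mem_powersum_semiring:
  "(\<And>x. x \<in> S \<Longrightarrow> F x \<in> powersum_semiring) \<Longrightarrow> (\<Sum>x\<in>S. F x) \<in> powersum_semiring"
  by (induction S rule: infinite_finite_induct) (auto intro: powersum_semiring.intros)

theorem theorem1p41:
  fixes D :: "'a pair_pre_digraph"
  assumes "pair_fin_digraph D"
    and "\<not> (\<exists>u\<in>pverts D. \<exists>v\<in>pverts D. u \<noteq> v \<and> (u, v) \<in> parcs D \<and> (v, u) \<in> parcs D)"
  shows "redei_berge D \<in> powersum_semiring \<and>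
    redei_berge D =
      (\<Sum>\<sigma>\<in>{\<sigma> \<in> cycle_perms D. \<forall>\<gamma>\<in>perm_cycles (pverts D) \<sigma>. \<not> risky D \<gamma>}.
        powersum_partition (perm_type (pverts D) \<sigma>))"
proof -
  interpret pair_fin_digraph D by fact
  have V: "finite (pverts D)" by (rule pair_finite_verts)
  \<comment> \<open>Arcs join vertices, so the assumption on pairs of vertices covers all
    pairs.\<close>
  have antisym: "u = v" if "(u, v) \<in> parcs D" "(v, u) \<in> parcs D" for u v
    using assms(2) that in_arcsD1 by blast
  have "redei_berge D =
      (\<Sum>\<sigma>\<in>safe_perms (parcs D) (pverts D). powersum_partition (perm_type (pverts D) \<sigma>))"
  proof (rule mfps_eqI)
    fix m
    \<comment> \<open>Both coefficients count pairs of a safe permutation and a labelling with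
      content \<open>m\<close> that is invariant under it.\<close>
    show "mcoeff (redei_berge D) m =
        mcoeff (\<Sum>\<sigma>\<in>safe_perms (parcs D) (pverts D). powersum_partition (perm_type (pverts D) \<sigma>)) m"
      unfolding mcoeff_sum
    proof (subst mcoeff_redei_berge[OF V])
      show "u = v" if "(u, v) \<in> parcs D" "(v, u) \<in> parcs D" for u v
        using antisym that .
    qed (intro sum.cong refl mcoeff_powersum_partition_perm_type[symmetric] V, simp add: safe_perms_def)
  qed
  \<comment> \<open>Positivity is read off the expansion: each summand is a product of generators,
    since cycles are nonempty and have length at least 1.\<close>
  moreover have "powersum_partition (perm_type (pverts D) \<sigma>) \<in> powersum_semiring"
    if "\<sigma> \<in> safe_perms (parcs D) (pverts D)" for \<sigma>
  proof (rule powersum_partition_mem_powersum_semiring)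
    have "\<sigma> permutes pverts D" using that by (simp add: safe_perms_def)
    then have perm: "permutation \<sigma>" using V permutation_permutes by blast
    have "1 \<le> rot_length (rot_class (support \<sigma> i))" for i
      using rot_length_rot_class[OF support_nonempty[OF perm]] support_nonempty[OF perm, of i]
      by (metis One_nat_def Suc_leI length_greater_0_conv)
    then show "\<forall>k\<in>#perm_type (pverts D) \<sigma>. 1 \<le> k"
      using V by (auto simp: perm_type_def perm_cycles_def)
  qed
  ultimately show ?thesis
    unfolding safe_perms_eq[OF V] by (auto intro: sum_mem_powersum_semiring)
qed

end
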